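(* Let $\rho$ be an entangled mixed state of two qubits. The bipartite local filtering operations that probabilistically bring $\rho$ to a state with the highest possible fidelity $F$ are given by the filtering operations bringing $\rho$ into its unique Bell-diagonal normal form, and these yield a fidelity larger than $1/2$.
   Context: A state of two qubits is a positive semidefinite operator of trace one on $\mathbb{C}^2\otimes\mathbb{C}^2$; it is separable if it is a convex combination of product states and entangled otherwise. The fidelity (maximal singlet fraction) of a state $\rho$ is $F(\rho)=\max_{|\psi\rangle}\langle\psi|\rho|\psi\rangle$, the maximum being over all maximally entangled unit vectors $|\psi\rangle\in\mathbb{C}^2\otimes\mathbb{C}^2$, i.e. $|\psi\rangle=(U\otimes V)(|00\rangle+|11\rangle)/\sqrt2$ with $U,V$ unitary. A bipartite local filtering operation is given by a pair of $2\times2$ complex matrices $A,B$ (contractions), one for each party; it succeeds with probability $p_{AB}=\mathrm{Tr}\big((A\otimes B)\rho(A\otimes B)^\dagger\big)$, and in case of success it yields the state $(A\otimes B)\rho(A\otimes B)^\dagger/p_{AB}$. A state is Bell-diagonal if it is diagonal in the Bell basis $(|00\rangle\pm|11\rangle)/\sqrt2$, $(|01\rangle\pm|10\rangle)/\sqrt2$. The Bell-diagonal normal form of $\rho$ is the unique Bell-diagonal state into which $\rho$ is brought by local filtering operations; its existence and uniqueness are taken from earlier work. *)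

theory Defs
  imports "HOL-Analysis.Analysis"
begin

text \<open>The basis of the one-qubit space is indexed by the two elements 0 and 1 of the numeral type
  2; the basis of the tensor product of two such spaces is indexed by pairs.\<close>

type_synonym qubit_op = "complex^2^2"
type_synonym two_qubit_vec = "complex^(2 \<times> 2)"
type_synonym two_qubit_op = "complex^(2 \<times> 2)^(2 \<times> 2)"

definition dagger :: "complex^'n^'m \<Rightarrow> complex^'m^'n" where
  "dagger M = map_matrix cnj (transpose M)"

definition braket :: "complex^'n \<Rightarrow> complex^'n \<Rightarrow> complex" where
  "braket u v = (\<Sum>i\<in>UNIV. cnj (u $ i) * v $ i)"

definition tensor_op :: "complex^'n^'n \<Rightarrow> complex^'m^'m \<Rightarrow> complex^('n \<times> 'm)^('n \<times> 'm)"
    (infixr "\<otimes>\<^sub>o" 75) where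
  "A \<otimes>\<^sub>o B = (\<chi> i j. A $ fst i $ fst j * B $ snd i $ snd j)"

definition unitary :: "complex^'n^'n \<Rightarrow> bool" where
  "unitary U \<longleftrightarrow> dagger U ** U = mat 1 \<and> U ** dagger U = mat 1"

definition contraction :: "complex^'n^'n \<Rightarrow> bool" where
  "contraction A \<longleftrightarrow> (\<forall>v. norm (A *v v) \<le> norm v)"

text \<open>For Hermitian operators the braket below is real, so taking its real part loses nothing.\<close>

definition pos_semidef :: "complex^'n^'n \<Rightarrow> bool" where
  "pos_semidef M \<longleftrightarrow> dagger M = M \<and> (\<forall>v. 0 \<le> Re (braket v (M *v v)))"

definition state :: "complex^'n^'n \<Rightarrow> bool" where
  "state \<rho> \<longleftrightarrow> pos_semidef \<rho> \<and> trace \<rho> = 1"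

definition separable :: "two_qubit_op \<Rightarrow> bool" where
  "separable \<rho> \<longleftrightarrow> \<rho> \<in> convex hull {\<sigma> \<otimes>\<^sub>o \<tau> | (\<sigma> :: qubit_op) (\<tau> :: qubit_op). state \<sigma> \<and> state \<tau>}"

definition entangled :: "two_qubit_op \<Rightarrow> bool" where
  "entangled \<rho> \<longleftrightarrow> \<not> separable \<rho>"

definition ket :: "2 \<Rightarrow> 2 \<Rightarrow> two_qubit_vec" where
  "ket i j = axis (i, j) 1"

definition bell_basis :: "two_qubit_vec set" where
  "bell_basis =
    {(1 / sqrt 2) *\<^sub>R (ket 0 0 + ket 1 1), (1 / sqrt 2) *\<^sub>R (ket 0 0 - ket 1 1),
     (1 / sqrt 2) *\<^sub>R (ket 0 1 + ket 1 0), (1 / sqrt 2) *\<^sub>R (ket 0 1 - ket 1 0)}"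

definition maximally_entangled :: "two_qubit_vec \<Rightarrow> bool" where
  "maximally_entangled \<psi> \<longleftrightarrow>
    (\<exists>U V :: qubit_op. unitary U \<and> unitary V \<and>
       \<psi> = (U \<otimes>\<^sub>o V) *v ((1 / sqrt 2) *\<^sub>R (ket 0 0 + ket 1 1)))"

text \<open>The maximally entangled vectors form a nonempty compact set, so this supremum is a maximum.\<close>

definition fidelity :: "two_qubit_op \<Rightarrow> real" where
  "fidelity \<rho> = (SUP \<psi> \<in> {\<psi>. maximally_entangled \<psi>}. Re (braket \<psi> (\<rho> *v \<psi>)))"

definition bell_diagonal :: "two_qubit_op \<Rightarrow> bool" where
  "bell_diagonal \<rho> \<longleftrightarrow>
    state \<rho> \<and> (\<forall>u\<in>bell_basis. \<forall>v\<in>bell_basis. u \<noteq> v \<longrightarrow> braket u (\<rho> *v v) = 0)"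

definition success_prob :: "qubit_op \<Rightarrow> qubit_op \<Rightarrow> two_qubit_op \<Rightarrow> real" where
  "success_prob A B \<rho> = Re (trace ((A \<otimes>\<^sub>o B) ** \<rho> ** dagger (A \<otimes>\<^sub>o B)))"

definition filtered :: "qubit_op \<Rightarrow> qubit_op \<Rightarrow> two_qubit_op \<Rightarrow> two_qubit_op" where
  "filtered A B \<rho> = (1 / success_prob A B \<rho>) *\<^sub>R ((A \<otimes>\<^sub>o B) ** \<rho> ** dagger (A \<otimes>\<^sub>o B))"

text \<open>Filters that never succeed on the given state yield no output and are excluded.\<close>

definition filters :: "two_qubit_op \<Rightarrow> (qubit_op \<times> qubit_op) set" where
  "filters \<rho> = {(A, B). contraction A \<and> contraction B \<and> 0 < success_prob A B \<rho>}"

definition optimal_filters :: "two_qubit_op \<Rightarrow> (qubit_op \<times> qubit_op) set" where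
  "optimal_filters \<rho> = {(A, B) \<in> filters \<rho>.
     \<forall>(A', B') \<in> filters \<rho>. fidelity (filtered A' B' \<rho>) \<le> fidelity (filtered A B \<rho>)}"

text \<open>Local unitaries permute the Bell states, so a Bell-diagonal normal form is unique only up to
  local unitaries. It is therefore given as a relation, and bringing a state into the normal form is
  understood up to local unitaries.\<close>

definition bell_diagonal_normal_form :: "two_qubit_op \<Rightarrow> two_qubit_op \<Rightarrow> bool" where
  "bell_diagonal_normal_form \<rho> \<beta> \<longleftrightarrow>
    bell_diagonal \<beta> \<and> (\<exists>(A, B) \<in> filters \<rho>. filtered A B \<rho> = \<beta>)"

definition locally_unitarily_equivalent :: "two_qubit_op \<Rightarrow> two_qubit_op \<Rightarrow> bool" where
  "locally_unitarily_equivalent \<rho> \<sigma> \<longleftrightarrow>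
    (\<exists>U V :: qubit_op. unitary U \<and> unitary V \<and> \<sigma> = (U \<otimes>\<^sub>o V) ** \<rho> ** dagger (U \<otimes>\<^sub>o V))"

definition filters_into :: "two_qubit_op \<Rightarrow> two_qubit_op \<Rightarrow> (qubit_op \<times> qubit_op) set" where
  "filters_into \<rho> \<beta> = {(A, B) \<in> filters \<rho>. locally_unitarily_equivalent (filtered A B \<rho>) \<beta>}"

end

theory Submission
  imports Defs
begin

text \<open>Identify vectors with \<open>2 \<times> 2\<close> matrices, so that \<open>A \<otimes> B\<close> acts as \<open>X \<mapsto> A X B\<^sup>T\<close>; up to
  factors the Bell basis becomes the basis \<open>1, \<i>\<sigma>\<^sub>1, \<i>\<sigma>\<^sub>2, \<i>\<sigma>\<^sub>3\<close> of quaternion units and the maximally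
  entangled vectors become the unitary matrices.

  A Bell-diagonal state with weights \<open>p\<^sub>i\<close> filtered by \<open>A, B\<close> has unnormalised trace \<open>S\<close>
  and overlap \<open>f\<close> with a fixed maximally entangled vector, and \<open>S - 2f\<close> is half the sum of
  \<open>(1/2 - p\<^sub>i) \<bar>t\<^sub>i\<bar>\<^sup>2\<close>, where the \<open>t\<^sub>i\<close> are coordinates with \<open>\<Sum> t\<^sub>i\<^sup>2\<close> equal to four times a number of
  modulus \<open>\<bar>det A det B\<bar> \<le> S\<close>.  Hence no filter gives fidelity above \<open>1/2\<close> if all \<open>p\<^sub>i \<le> 1/2\<close>,
  and if \<open>p\<^sub>k > 1/2\<close> then none exceeds \<open>p\<^sub>k\<close>, with equality only if \<open>S = \<bar>det A det B\<bar>\<close>, which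
  forces the output to be locally unitarily equivalent to the input.

  At a critical point over local filters of a weighted sum of diagonal entries, with weights \<open>d\<^sub>i\<close>,
  every off-diagonal entry \<open>w\<^sub>i\<^sub>j\<close> satisfies \<open>(d\<^sub>i - d\<^sub>j) Re w\<^sub>i\<^sub>j = 0\<close> and
  \<open>(d\<^sub>i + d\<^sub>j) Im w\<^sub>i\<^sub>j = 0\<close>.  Applied to a full-rank state this brings it to Bell-diagonal form; if
  no filter gains fidelity the weights are then at most \<open>1/2\<close> and the state is separable, and the
  general case follows by adding noise.  Applied to the output of an optimal filter, whose fidelity
  \<open>F\<close> exceeds \<open>1/2\<close>, with weights \<open>F - 1, F, F, F\<close>, it shows that the output is real in the
  quaternion basis, hence Bell-diagonal up to local unitaries.\<close>

section \<open>Two-qubit vectors as matrices\<close>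

lemma sum_pair2: "(\<Sum>p\<in>UNIV. f p) = f (1,1) + f (1,2) + f (2,1) + (f (2::2,2::2) :: 'a::comm_monoid_add)"
proof -
  have "(\<Sum>p\<in>UNIV. f p) = (\<Sum>i\<in>UNIV. \<Sum>j\<in>UNIV. f (i,j))"
    by (simp add: sum.cartesian_product UNIV_Times_UNIV[symmetric] del: UNIV_Times_UNIV)
  then show ?thesis by (simp add: sum_2 add_ac)
qed

lemma all_pair2: "(\<forall>p. P p) \<longleftrightarrow> P (1,1) \<and> P (1,2) \<and> P (2,1) \<and> P (2::2,2::2)"
  by (simp add: split_paired_All forall_2)

lemma sum_lt4: "(\<Sum>i<(4::nat). f i) = f 0 + f 1 + f 2 + (f 3 :: 'a::comm_monoid_add)"
  by (simp add: eval_nat_numeral)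

definition vec_of :: "qubit_op \<Rightarrow> two_qubit_vec" where
  "vec_of X = (\<chi> p. X $ fst p $ snd p)"

definition conj_op :: "qubit_op \<Rightarrow> qubit_op" where
  "conj_op X = map_matrix cnj X"

text \<open>The adjugate matrix. It is complex linear where the adjoint is antilinear, and the two
  agree exactly on real combinations of the quaternion units.\<close>

definition adj2 :: "qubit_op \<Rightarrow> qubit_op" where
  "adj2 X = (\<chi> i j. if i = j then (if i = 1 then X $ 2 $ 2 else X $ 1 $ 1) else - X $ i $ j)"

definition hs :: "qubit_op \<Rightarrow> qubit_op \<Rightarrow> complex" where
  "hs X Y = (\<Sum>i\<in>UNIV. \<Sum>j\<in>UNIV. cnj (X $ i $ j) * Y $ i $ j)"

definition form :: "two_qubit_op \<Rightarrow> qubit_op \<Rightarrow> qubit_op \<Rightarrow> complex" where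
  "form M X Y = braket (vec_of X) (M *v vec_of Y)"

text \<open>The adjoint of the filter action \<open>A ** X ** transpose B\<close> for the product
  \<open>hs\<close>. Filters are thus moved from the operator to the test matrices.\<close>

definition pull :: "qubit_op \<Rightarrow> qubit_op \<Rightarrow> qubit_op \<Rightarrow> qubit_op" where
  "pull A B X = dagger A ** X ** conj_op B"

definition quat :: "nat \<Rightarrow> qubit_op" where
  "quat k = (\<chi> i j. if k = 0 then (if i = j then 1 else 0)
     else if k = 1 then (if i = j then 0 else \<i>)
     else if k = 2 then (if i = j then 0 else if i = 1 then 1 else -1)
     else (if i = j then (if i = 1 then \<i> else -\<i>) else 0))"

lemmas mat2_simps = vec_eq_iff forall_2 all_pair2 matrix_matrix_mult_def matrix_vector_mult_def sum_2 sum_pair2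
  dagger_def conj_op_def adj2_def transpose_def map_matrix_def mat_def tensor_op_def vec_of_def hs_def trace_def det_2

lemma quat_entries [simp]:
  "quat 0 = mat 1"
  "quat (Suc 0) $ 1 $ 1 = 0" "quat (Suc 0) $ 1 $ 2 = \<i>" "quat (Suc 0) $ 2 $ 1 = \<i>" "quat (Suc 0) $ 2 $ 2 = 0"
  "quat 2 $ 1 $ 1 = 0" "quat 2 $ 1 $ 2 = 1" "quat 2 $ 2 $ 1 = -1" "quat 2 $ 2 $ 2 = 0"
  "quat 3 $ 1 $ 1 = \<i>" "quat 3 $ 1 $ 2 = 0" "quat 3 $ 2 $ 1 = 0" "quat 3 $ 2 $ 2 = -\<i>"
  by (simp_all add: quat_def mat_def vec_eq_iff)

lemma tensor_vec: "(A \<otimes>\<^sub>o B) *v vec_of X = vec_of (A ** X ** transpose B)"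
  by (simp add: mat2_simps algebra_simps)

lemma dagger_tensor: "dagger (A \<otimes>\<^sub>o B) = dagger A \<otimes>\<^sub>o dagger (B :: qubit_op)" for A :: qubit_op
  by (simp add: mat2_simps)

lemma tensor_mult: "(A \<otimes>\<^sub>o B) ** (A' \<otimes>\<^sub>o B') = (A ** A') \<otimes>\<^sub>o (B ** (B' :: qubit_op))" for A A' :: qubit_op
  by (simp add: mat2_simps algebra_simps)

lemma braket_mult: "braket u (M *v v) = braket (dagger M *v u) v" for M :: "complex^'n^'n"
proof -
  have "braket u (M *v v) = (\<Sum>i\<in>UNIV. \<Sum>j\<in>UNIV. cnj (u$i) * (M$i$j * v$j))"
    by (simp add: braket_def matrix_vector_mult_def sum_distrib_left)
  also have "\<dots> = (\<Sum>j\<in>UNIV. \<Sum>i\<in>UNIV. cnj (u$i) * (M$i$j * v$j))" by (rule sum.swap)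
  also have "\<dots> = braket (dagger M *v u) v"
    by (simp add: braket_def matrix_vector_mult_def dagger_def transpose_def map_matrix_def sum_distrib_left sum_distrib_right mult_ac)
  finally show ?thesis .
qed

lemma dagger_dagger [simp]: "dagger (dagger M) = M"
  by (simp add: dagger_def transpose_def map_matrix_def vec_eq_iff)

lemma dagger_mult: "dagger (M ** N) = dagger N ** dagger M" for M :: "complex^'n^'m" and N :: "complex^'k^'n"
  by (simp add: dagger_def transpose_def map_matrix_def matrix_matrix_mult_def vec_eq_iff mult_ac)

lemma form_conjugate:
  "form ((A \<otimes>\<^sub>o B) ** M ** dagger (A \<otimes>\<^sub>o B)) X Y = form M (pull A B X) (pull A B Y)"
proof -
  have t: "transpose (dagger B) = conj_op B" by (simp add: mat2_simps)
  show ?thesis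
    by (simp add: form_def matrix_vector_mul_assoc[symmetric] braket_mult[of _ "A \<otimes>\<^sub>o B"])
       (simp add: dagger_tensor tensor_vec t pull_def)
qed

lemma form_entries: "form M X Y = (\<Sum>p\<in>UNIV. \<Sum>q\<in>UNIV. cnj (X $ fst p $ snd p) * M $ p $ q * Y $ fst q $ snd q)"
  by (simp add: form_def braket_def matrix_vector_mult_def vec_of_def sum_distrib_left mult_ac)

lemma form_add_left: "form M (X + X') Y = form M X Y + form M X' Y"
  by (simp add: form_entries algebra_simps sum.distrib)
lemma form_add_right: "form M X (Y + Y') = form M X Y + form M X Y'"
  by (simp add: form_entries algebra_simps sum.distrib)
lemma form_scale_left: "form M (mat c ** X) Y = cnj c * form M X Y"
  by (simp add: form_entries mat2_simps algebra_simps)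
lemma form_scale_right: "form M X (mat c ** Y) = c * form M X Y"
  by (simp add: form_entries mat2_simps algebra_simps)
lemma trace_form: "trace M = (\<Sum>i<4. form M (quat i) (quat i)) / 2"
  by (simp add: form_entries sum_lt4 sum_pair2 trace_def mat_def algebra_simps)

lemma hs_expand: "mat 2 ** X = (\<Sum>i<4. mat (hs (quat i) X) ** quat i)"
  by (simp add: sum_lt4 mat2_simps algebra_simps)

lemma pull_scale: "pull A B (mat c ** X) = mat c ** pull A B X"
  by (simp add: pull_def mat2_simps algebra_simps)

lemma pull_add: "pull A B (X + Y) = pull A B X + pull A B Y"
  by (simp add: pull_def mat2_simps algebra_simps)

text \<open>The quaternion units span, so \<open>pull A B\<close> kills every matrix unit as well;
  the entries obtained there are all the conjugated products of an entry of \<open>A\<close> with an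
  entry of \<open>B\<close>.\<close>

lemma pull_quat_eq_0:
  assumes z: "\<And>i. i < 4 \<Longrightarrow> pull A B (quat i) = 0" and "B \<noteq> 0"
  shows "A = 0"
proof -
  have "pull A B (mat 2 ** X) = 0" for X
    unfolding hs_expand sum_lt4 pull_add pull_scale using z[of 0] by (simp add: z)
  then have "mat 2 ** pull A B X = 0" for X by (simp add: pull_scale)
  then have p: "pull A B X = 0" for X by (simp add: mat2_simps)
  have "cnj (A $ i $ k) * cnj (B $ j $ l) = 0" for i j k l
  proof -
    have "pull A B (\<chi> i' j'. if i' = i \<and> j' = j then 1 else 0) $ k $ l = cnj (A $ i $ k) * cnj (B $ j $ l)"
      using exhaust_2[of i] exhaust_2[of j] exhaust_2[of k] exhaust_2[of l]
      by (elim disjE; simp add: pull_def matrix_matrix_mult_def sum_2 dagger_def transpose_def map_matrix_def conj_op_def)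
    then show ?thesis by (simp only: p) simp
  qed
  then show ?thesis using \<open>B \<noteq> 0\<close> unfolding vec_eq_iff by (metis complex_cnj_zero_iff mult_eq_0_iff zero_index)
qed

lemma pull_one [simp]: "pull (mat 1) (mat 1) X = X"
  by (simp add: pull_def mat2_simps)

lemma pull_mult: "pull (A ** A') (B ** B') X = pull A' B' (pull A B X)"
proof -
  have "conj_op (B ** B') = conj_op B ** conj_op B'" by (simp add: mat2_simps)
  then show ?thesis by (simp add: pull_def dagger_mult matrix_mul_assoc)
qed

lemma form_hermitian: "dagger M = M \<Longrightarrow> form M Y X = cnj (form M X Y)"
  unfolding form_def braket_mult[of "vec_of Y"]
  by (simp add: braket_def mult_ac)

lemma form_add: "form (M + N) X Y = form M X Y + form N X Y"
  by (simp add: form_entries algebra_simps sum.distrib)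

lemma form_scaleR: "form (r *\<^sub>R M) X Y = of_real r * form M X Y"
  by (simp add: form_entries sum_distrib_left mult_ac scaleR_conv_of_real[where 'a=complex])

text \<open>Matrix units recover the entries. Most operator identities below go through this
  criterion, because filters act on forms simply by \<open>pull\<close>.\<close>

lemma form_eq_iff: "M = N \<longleftrightarrow> (\<forall>X Y. form M X Y = form N X Y)"
proof
  assume a: "\<forall>X Y. form M X Y = form N X Y"
  define E :: "2 \<times> 2 \<Rightarrow> qubit_op" where "E p = (\<chi> i j. if (i, j) = p then 1 else 0)" for p
  have e: "form L (E p) (E q) = L $ p $ q" for L p q
  proof -
    have v: "vec_of (E r) = axis r 1" for r
      by (auto simp: vec_of_def E_def axis_def vec_eq_iff)
    have "braket (axis p 1) w = w $ p" for w :: two_qubit_vec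
    proof -
      have "braket (axis p 1) w = (\<Sum>i\<in>UNIV. if i = p then w $ i else 0)"
        unfolding braket_def by (rule sum.cong) (auto simp: axis_def)
      then show ?thesis by simp
    qed
    moreover have "(L *v axis q 1) $ p = (\<Sum>i\<in>UNIV. if i = q then L $ p $ i else 0)"
      unfolding matrix_vector_mult_def vec_lambda_beta by (rule sum.cong) (auto simp: axis_def)
    ultimately show ?thesis by (simp add: form_def v)
  qed
  have "M $ p $ q = N $ p $ q" for p q
    using a e by metis
  then show "M = N" by (simp add: vec_eq_iff)
qed simp

lemma vec_of_surj: "\<exists>X. v = vec_of X"
  by (rule exI[of _ "\<chi> i j. v $ (i, j)"]) (simp add: vec_of_def vec_eq_iff)

section \<open>Positivity, unitary matrices and the fidelity\<close>

lemma psd_form_nonneg: "pos_semidef M \<Longrightarrow> 0 \<le> Re (form M X X)"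
  by (simp add: pos_semidef_def form_def)

lemma psd_iff_form: "pos_semidef M \<longleftrightarrow> dagger M = M \<and> (\<forall>X. 0 \<le> Re (form M X X))"
  unfolding pos_semidef_def form_def by (metis vec_of_surj)

lemma hs_self: "hs X X = of_real ((norm X)\<^sup>2)"
  by (simp add: hs_def norm_vec_def L2_set_def sum_2 complex_norm_square[symmetric] mult.commute[of "cnj _"])

lemma norm_sq_hs: "(norm X)\<^sup>2 = Re (hs X X)"
  by (simp add: hs_self)

lemma hs_cnj: "hs Y X = cnj (hs X Y)"
  by (simp add: hs_def mult.commute)

lemma unitary_norm:
  assumes "unitary (U :: qubit_op)" shows "(norm U)\<^sup>2 = 2"
proof -
  have "hs U U = trace (dagger U ** U)" by (simp add: mat2_simps algebra_simps)
  also have "\<dots> = 2" using assms by (simp add: unitary_def trace_def mat_def)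
  finally show ?thesis by (simp add: norm_sq_hs)
qed

lemma continuous_on_form: "continuous_on UNIV (\<lambda>X. form M X X)"
  unfolding form_entries by (intro continuous_intros)

lemma continuous_on_dagger_mult: "continuous_on UNIV (\<lambda>U::qubit_op. dagger U ** U)"
  "continuous_on UNIV (\<lambda>U::qubit_op. U ** dagger U)"
  unfolding matrix_matrix_mult_def dagger_def transpose_def map_matrix_def
  by (auto intro!: continuous_intros)

lemma compact_unitary: "compact {U :: qubit_op. unitary U}"
proof (rule compact_eq_bounded_closed[THEN iffD2], intro conjI)
  have "norm U \<le> sqrt 2" if "unitary U" for U :: qubit_op
    using unitary_norm[OF that] by (simp add: real_le_rsqrt)
  then show "bounded {U :: qubit_op. unitary U}" by (auto simp: bounded_iff)
  have "closed {U :: qubit_op. dagger U ** U = mat 1}" "closed {U :: qubit_op. U ** dagger U = mat 1}"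
    by (intro closed_Collect_eq continuous_on_dagger_mult continuous_on_const)+
  then show "closed {U :: qubit_op. unitary U}"
    unfolding unitary_def Collect_conj_eq by (rule closed_Int)
qed

lemma unitary_one [simp]: "unitary (mat 1)"
  by (simp add: unitary_def dagger_def transpose_mat) (simp add: mat_def map_matrix_def vec_eq_iff)

lemma unitary_mult: "unitary U \<Longrightarrow> unitary V \<Longrightarrow> unitary (U ** V)" for U V :: "complex^'n^'n"
  unfolding unitary_def dagger_mult by (metis matrix_mul_assoc matrix_mul_lid)

lemma unitary_dagger: "unitary U \<Longrightarrow> unitary (dagger U)"
  by (simp add: unitary_def)

lemma unitary_transpose: "unitary U \<Longrightarrow> unitary (transpose U)" for U :: qubit_op
  unfolding unitary_def by (simp add: mat2_simps mult_ac)

lemma unitary_conj_op: "unitary U \<Longrightarrow> unitary (conj_op U)"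
  using unitary_dagger[OF unitary_transpose, of U]
  by (simp add: dagger_def conj_op_def)

lemma unitary_quat [simp]: "i < 4 \<Longrightarrow> unitary (quat i)"
proof -
  assume "i < 4"
  then have "i \<in> {0,1,2,3}" by auto
  then show ?thesis by (auto simp: unitary_def) (simp_all add: mat2_simps)
qed

text \<open>The vector of \<open>mat 1\<close> is sent to that of \<open>U ** transpose V\<close>,
  and already \<open>V = mat 1\<close> yields every unitary.\<close>

lemma maximally_entangled_iff:
  "maximally_entangled \<psi> \<longleftrightarrow> (\<exists>W. unitary W \<and> \<psi> = (1 / sqrt 2) *\<^sub>R vec_of W)"
proof -
  have k: "ket 0 0 + ket 1 1 = vec_of (mat 1)"
    by (simp add: ket_def mat2_simps axis_def)
  have s: "M *v (r *\<^sub>R v) = r *\<^sub>R (M *v v)" for M :: two_qubit_op and r v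
    by (simp add: matrix_vector_mult_def vec_eq_iff scaleR_sum_right)
  show ?thesis (is "?l = ?r")
  proof
    assume ?l
    then obtain U V where "unitary U" "unitary V"
      "\<psi> = (U \<otimes>\<^sub>o V) *v ((1 / sqrt 2) *\<^sub>R (ket 0 0 + ket 1 1))"
      unfolding maximally_entangled_def by blast
    then show ?r by (auto simp: s k tensor_vec intro!: exI[of _ "U ** transpose V"] unitary_mult unitary_transpose)
  next
    assume ?r
    then obtain W where "unitary W" "\<psi> = (1 / sqrt 2) *\<^sub>R vec_of W" by blast
    then show ?l unfolding maximally_entangled_def
      by (intro exI[of _ W] exI[of _ "mat 1"]) (simp add: s k tensor_vec transpose_mat)
  qed
qed

lemma fidelity_form: "fidelity M = (SUP W\<in>{W. unitary W}. Re (form M W W) / 2)"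
proof -
  have "{\<psi>. maximally_entangled \<psi>} = (\<lambda>W. (1 / sqrt 2) *\<^sub>R vec_of W) ` {W. unitary W}"
    by (auto simp: maximally_entangled_iff)
  moreover have "Re (braket ((1 / sqrt 2) *\<^sub>R vec_of W) (M *v ((1 / sqrt 2) *\<^sub>R vec_of W))) = Re (form M W W) / 2" for W
  proof -
    have a: "M *v (r *\<^sub>R v) = r *\<^sub>R (M *v v)" for r v
      by (simp add: matrix_vector_mult_def vec_eq_iff scaleR_sum_right)
    have b: "braket (r *\<^sub>R v) (r *\<^sub>R w) = of_real (r * r) * braket v w" for r and v w :: two_qubit_vec
      by (simp add: braket_def sum_distrib_left mult_ac scaleR_conv_of_real[where 'a=complex])
    show ?thesis unfolding a b form_def by simp
  qed
  ultimately show ?thesis by (simp only: fidelity_def image_image)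
qed

text \<open>Compactness of the unitary group turns the supremum into a maximum; the maximiser
  \<open>W\<close> can later be absorbed into a filter.\<close>

lemma fidelity_attained:
  obtains W where "unitary W" "fidelity M = Re (form M W W) / 2"
    "\<And>W'. unitary W' \<Longrightarrow> Re (form M W' W') \<le> Re (form M W W)"
proof -
  have "continuous_on {W. unitary W} (\<lambda>W. Re (form M W W))"
    by (intro continuous_intros continuous_on_subset[OF continuous_on_form]) auto
  then obtain W where W: "unitary W" "\<And>W'. unitary W' \<Longrightarrow> Re (form M W' W') \<le> Re (form M W W)"
    using continuous_attains_sup[OF compact_unitary, of "\<lambda>W. Re (form M W W)"] unitary_one by blast
  moreover from W have "fidelity M = Re (form M W W) / 2"
    unfolding fidelity_form by (intro cSup_eq_maximum) auto
  ultimately show thesis using that by blast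
qed

lemma fidelity_ge: "unitary W \<Longrightarrow> Re (form M W W) / 2 \<le> fidelity M"
  by (metis fidelity_attained divide_right_mono zero_le_numeral)


text \<open>The Bell vectors are the vectors of the four quaternion units up to the factor
  \<open>1 / sqrt 2\<close> and a phase.\<close>

lemma bell_basis_quat:
  obtains c :: "nat \<Rightarrow> complex" where "\<And>k. c k \<noteq> 0"
    "bell_basis = (\<lambda>k. (1 / sqrt 2) *\<^sub>R vec_of (mat (c k) ** quat k)) ` {..<4}"
proof
  \<comment> \<open>In the index type \<open>2\<close> the numerals 0 and 2 coincide, so
    \<open>ket 0 0\<close> sits at the entry (2,2); this fixes the phases.\<close>
  define c :: "nat \<Rightarrow> complex" where "c k = (if k = 0 then 1 else if k = 1 then -\<i> else if k = 2 then -1 else \<i>)" for k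
  show "c k \<noteq> 0" for k by (simp add: c_def)
  have "{..<4::nat} = {0,1,2,3}" by auto
  moreover have "ket 0 0 + ket 1 1 = vec_of (mat (c 0) ** quat 0)" "ket 0 0 - ket 1 1 = vec_of (mat (c 3) ** quat 3)"
    "ket 0 1 + ket 1 0 = vec_of (mat (c 1) ** quat 1)" "ket 0 1 - ket 1 0 = vec_of (mat (c 2) ** quat 2)"
    by (simp_all add: ket_def mat2_simps axis_def c_def)
  ultimately show "bell_basis = (\<lambda>k. (1 / sqrt 2) *\<^sub>R vec_of (mat (c k) ** quat k)) ` {..<4}"
    by (auto simp: bell_basis_def)
qed

lemma hs_quat: "i < 4 \<Longrightarrow> j < 4 \<Longrightarrow> hs (quat i) (quat j) = (if i = j then 2 else 0)"
proof -
  assume "i < 4" "j < 4"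
  then have "i \<in> {0,1,2,3}" "j \<in> {0,1,2,3}" by auto
  then show ?thesis by (auto simp: mat2_simps)
qed

lemma hs_scale_right: "hs X (mat c ** Y) = c * hs X Y"
  by (simp add: mat2_simps algebra_simps)

lemma bell_diagonal_iff:
  "bell_diagonal \<rho> \<longleftrightarrow> state \<rho> \<and> (\<forall>i<4. \<forall>j<4. i \<noteq> j \<longrightarrow> form \<rho> (quat i) (quat j) = 0)"
proof -
  obtain c :: "nat \<Rightarrow> complex" where c: "\<And>k. c k \<noteq> 0" and
    b: "bell_basis = (\<lambda>k. (1 / sqrt 2) *\<^sub>R vec_of (mat (c k) ** quat k)) ` {..<4}"
    by (rule bell_basis_quat) blast
  let ?b = "\<lambda>k. (1 / sqrt 2) *\<^sub>R vec_of (mat (c k) ** quat k)"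
  \<comment> \<open>\<open>bell_diagonal\<close> speaks of distinct vectors, the new criterion of
    distinct indices.\<close>
  have inj: "i = j" if "?b i = ?b j" "i < 4" "j < 4" for i j
  proof -
    have "mat (c i) ** quat i = mat (c j) ** quat j"
      using that(1) by (simp add: vec_of_def vec_eq_iff)
    then have "c i * hs (quat i) (quat i) = c j * hs (quat i) (quat j)"
      by (metis hs_scale_right)
    then show ?thesis using hs_quat that(2,3) c by (auto split: if_splits)
  qed
  have f: "braket (?b i) (\<rho> *v ?b j) = 0 \<longleftrightarrow> form \<rho> (quat i) (quat j) = 0" for i j
  proof -
    have a: "M *v (r *\<^sub>R v) = r *\<^sub>R (M *v v)" for M :: two_qubit_op and r v
      by (simp add: matrix_vector_mult_def vec_eq_iff scaleR_sum_right)
    have b: "braket (r *\<^sub>R v) (r *\<^sub>R w) = of_real (r * r) * braket v w" for r and v w :: two_qubit_vec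
      by (simp add: braket_def sum_distrib_left mult_ac scaleR_conv_of_real[where 'a=complex])
    show ?thesis unfolding a b form_def[symmetric] form_scale_left form_scale_right using c by simp
  qed
  have "?b i \<noteq> ?b j \<longleftrightarrow> i \<noteq> j" if "i < 4" "j < 4" for i j using inj[OF _ that] by auto
  then show ?thesis unfolding bell_diagonal_def b using f by (auto simp del: scaleR_left.minus)
qed

section \<open>Filters acting on Bell-diagonal states\<close>

lemma hs_pull: "hs X (pull A B Y) = hs (A ** X ** transpose B) Y"
  by (simp add: pull_def mat2_simps algebra_simps)

lemma hs_trace: "hs X Y = trace (dagger X ** Y)"
  by (simp add: mat2_simps algebra_simps)

lemma hs_parseval: "hs X Y = (\<Sum>i<4. cnj (hs (quat i) X) * hs (quat i) Y) / 2"
  by (simp add: sum_lt4 mat2_simps algebra_simps)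

lemma norm_sq_parseval: "(norm X)\<^sup>2 = (\<Sum>i<4. (cmod (hs (quat i) X))\<^sup>2) / 2"
proof -
  have "of_real ((norm X)\<^sup>2) = (of_real ((\<Sum>i<4. (cmod (hs (quat i) X))\<^sup>2) / 2) :: complex)"
    unfolding hs_self[symmetric] hs_parseval[of X X]
    by (simp add: complex_norm_square[symmetric] mult.commute[of "cnj _"])
  then show ?thesis using of_real_eq_iff by blast
qed

lemma form_expand:
  "form M X Y = (\<Sum>i<4. \<Sum>j<4. cnj (hs (quat i) X) * hs (quat j) Y * form M (quat i) (quat j)) / 4"
proof -
  have "4 * form M X Y = form M (mat 2 ** X) (mat 2 ** Y)" by (simp add: form_scale_left form_scale_right)
  also have "\<dots> = (\<Sum>i<4. \<Sum>j<4. cnj (hs (quat i) X) * hs (quat j) Y * form M (quat i) (quat j))"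
    unfolding hs_expand sum_lt4 form_add_left form_add_right form_scale_left form_scale_right
    by (simp add: algebra_simps del: quat_entries)
  finally show ?thesis by (metis nonzero_mult_div_cancel_left zero_neq_numeral)
qed

text \<open>The factor 1/2 normalises \<open>quat i\<close>, whose squared norm is 2; on
  Bell-diagonal states these are the eigenvalues.\<close>

definition weight :: "two_qubit_op \<Rightarrow> nat \<Rightarrow> real" where
  "weight M i = Re (form M (quat i) (quat i)) / 2"

text \<open>Bell-diagonality without positivity and trace one, so that it also covers unnormalised
  filter outputs.\<close>

definition quat_diagonal :: "two_qubit_op \<Rightarrow> bool" where
  "quat_diagonal M \<longleftrightarrow> dagger M = M \<and> (\<forall>i<4. \<forall>j<4. i \<noteq> j \<longrightarrow> form M (quat i) (quat j) = 0)"

lemma form_self_real: "dagger M = M \<Longrightarrow> form M X X = of_real (Re (form M X X))"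
  by (metis Reals_cases Reals_cnj_iff Re_complex_of_real form_hermitian)

lemma form_quat_diagonal:
  assumes "quat_diagonal M"
  shows "form M X Y = (\<Sum>i<4. of_real (weight M i) * cnj (hs (quat i) X) * hs (quat i) Y) / 2"
proof -
  have "form M (quat i) (quat i) = 2 * of_real (weight M i)" for i
    using form_self_real assms by (simp add: weight_def quat_diagonal_def)
  moreover have "form M (quat i) (quat j) = 0" if "i < 4" "j < 4" "i \<noteq> j" for i j
    using assms that by (simp add: quat_diagonal_def)
  ultimately show ?thesis
    unfolding form_expand[of M X Y] sum_lt4 by (simp add: algebra_simps del: quat_entries)
qed

lemma det_quat [simp]: "i < 4 \<Longrightarrow> det (quat i) = 1"
proof -
  assume "i < 4"
  then have "i \<in> {0,1,2,3}" by auto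
  then show ?thesis by (auto simp: mat2_simps)
qed

text \<open>The partial transpose in disguise: the flip operator is the partial transpose of a Bell
  projection, and \<open>G\<close> is the filter pair with the second factor transported to the first.\<close>

lemma norm_sq_minus_trace_sq:
  fixes A B :: qubit_op
  defines "G \<equiv> B ** dagger (adj2 A)"
  shows "(norm (A ** B))\<^sup>2 - (cmod (trace (A ** B)))\<^sup>2 = (norm G)\<^sup>2 - (cmod (trace G))\<^sup>2"
proof -
  \<comment> \<open>The squared moduli of the diagonal entries cancel, leaving an identity
    polynomial in the entries and their conjugates.\<close>
  have e: "of_real ((norm X)\<^sup>2 - (cmod (trace X))\<^sup>2) =
      (X$1$2 * cnj (X$1$2) + X$2$1 * cnj (X$2$1) - X$1$1 * cnj (X$2$2) - X$2$2 * cnj (X$1$1) :: complex)"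
    for X :: qubit_op
    by (simp add: of_real_diff hs_self[symmetric] complex_norm_square del: of_real_power)
       (simp add: mat2_simps algebra_simps)
  have "of_real ((norm (A ** B))\<^sup>2 - (cmod (trace (A ** B)))\<^sup>2) = (of_real ((norm G)\<^sup>2 - (cmod (trace G))\<^sup>2) :: complex)"
    unfolding e G_def
    by (simp add: matrix_matrix_mult_def sum_2 dagger_def transpose_def map_matrix_def adj2_def) (simp add: algebra_simps)
  then show ?thesis using of_real_eq_iff by blast
qed

lemma norm_unitary_mult: "unitary U \<Longrightarrow> norm (U ** X) = norm X" for U X :: qubit_op
proof -
  assume "unitary U"
  then have "hs (U ** X) (U ** X) = hs X X"
    unfolding hs_trace dagger_mult unitary_def by (metis matrix_mul_assoc matrix_mul_rid)
  then show ?thesis by (simp add: hs_self flip: of_real_power)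
qed

text \<open>Parseval: each \<open>quat i\<close> is Hermitian or anti-Hermitian, so these traces are
  the quaternion coordinates up to sign.\<close>

lemma norm_sq_trace_quat: "(norm G)\<^sup>2 = (\<Sum>i<4. (cmod (trace (quat i ** G)))\<^sup>2) / 2"
proof -
  have "cmod (trace (quat i ** G)) = cmod (hs (quat i) G)" if "i < 4" for i
  proof -
    have "i \<in> {0,1,2,3}" using that by auto
    then have "dagger (quat i) = (if i = 0 then quat i else mat (-1) ** quat i)"
      by auto (simp_all add: mat2_simps)
    moreover have "trace (mat (-1) ** Y) = - trace Y" for Y :: qubit_op by (simp add: mat2_simps)
    ultimately show ?thesis by (auto simp: hs_trace matrix_mul_assoc[symmetric])
  qed
  then show ?thesis unfolding norm_sq_parseval by simp
qed

text \<open>The quaternion norm form, extended to complex coordinates without conjugation. Comparing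
  it with \<open>norm_sq_trace_quat\<close> is what produces the fidelity bound.\<close>

lemma det_trace_quat: "4 * det G = (\<Sum>i<4. (trace (quat i ** G))\<^sup>2)"
  by (simp add: sum_lt4 mat2_simps power2_eq_square algebra_simps)

text \<open>The arithmetic-geometric mean inequality on each of the two products in the
  determinant.\<close>

lemma norm_sq_ge_det: "2 * cmod (det X) \<le> (norm X)\<^sup>2" for X :: qubit_op
proof -
  have "(norm X)\<^sup>2 = (cmod (X$1$1))\<^sup>2 + (cmod (X$1$2))\<^sup>2 + (cmod (X$2$1))\<^sup>2 + (cmod (X$2$2))\<^sup>2"
    by (simp add: norm_vec_def L2_set_def sum_2)
  moreover have "cmod (det X) \<le> cmod (X$1$1) * cmod (X$2$2) + cmod (X$1$2) * cmod (X$2$1)"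
    using norm_triangle_ineq4[of "X$1$1 * X$2$2" "X$1$2 * X$2$1"] by (simp add: det_2 norm_mult)
  moreover have "2 * (a * b) \<le> a\<^sup>2 + b\<^sup>2" for a b :: real
    using sum_squares_bound[of a b] by simp
  ultimately show ?thesis by (smt (verit))
qed

text \<open>For a Bell-diagonal operator with weights \<open>p\<close>, this is the success
  probability and \<open>filter_overlap\<close> the unnormalised overlap with the maximally
  entangled vector of \<open>mat 1\<close>. Here \<open>B\<close> stands for the transposed second
  filter.\<close>

definition filter_mass :: "(nat \<Rightarrow> real) \<Rightarrow> qubit_op \<Rightarrow> qubit_op \<Rightarrow> real" where
  "filter_mass p A B = (\<Sum>i<4. p i * (norm (A ** quat i ** B))\<^sup>2) / 2"

definition filter_overlap :: "(nat \<Rightarrow> real) \<Rightarrow> qubit_op \<Rightarrow> qubit_op \<Rightarrow> real" where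
  "filter_overlap p A B = (\<Sum>i<4. p i * (cmod (trace (A ** quat i ** B)))\<^sup>2) / 4"

text \<open>Replacing \<open>B\<close> by \<open>quat i ** B\<close> in
  \<open>norm_sq_minus_trace_sq\<close> replaces \<open>G\<close> by \<open>quat i ** G\<close>,
  which has the norm of \<open>G\<close>. Since the weights sum to one, Parseval for
  \<open>G\<close> then collects the coefficients \<open>1 / 2 - p i\<close>.\<close>

lemma filter_mass_minus_overlap:
  fixes p A B
  defines "G \<equiv> B ** dagger (adj2 A)"
  assumes "(\<Sum>i<4. p i) = 1"
  shows "filter_mass p A B - 2 * filter_overlap p A B
    = (\<Sum>i<4. (1 / 2 - p i) * (cmod (trace (quat i ** G)))\<^sup>2) / 2"
proof -
  have "(norm (A ** quat i ** B))\<^sup>2 - (cmod (trace (A ** quat i ** B)))\<^sup>2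
      = (norm G)\<^sup>2 - (cmod (trace (quat i ** G)))\<^sup>2" if "i < 4" for i
    using norm_sq_minus_trace_sq[of A "quat i ** B"] norm_unitary_mult[OF unitary_quat[OF that], of G]
    by (simp add: matrix_mul_assoc G_def)
  then have "(\<Sum>i<4. p i * ((norm (A ** quat i ** B))\<^sup>2 - (cmod (trace (A ** quat i ** B)))\<^sup>2)) / 2
      = (\<Sum>i<4. p i * ((norm G)\<^sup>2 - (cmod (trace (quat i ** G)))\<^sup>2)) / 2" by simp
  moreover have "filter_mass p A B - 2 * filter_overlap p A B
      = (\<Sum>i<4. p i * ((norm (A ** quat i ** B))\<^sup>2 - (cmod (trace (A ** quat i ** B)))\<^sup>2)) / 2"
    unfolding filter_mass_def filter_overlap_def
    by (simp add: right_diff_distrib sum_subtractf diff_divide_distrib)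
  ultimately have "filter_mass p A B - 2 * filter_overlap p A B
     = (\<Sum>i<4. p i * ((norm G)\<^sup>2 - (cmod (trace (quat i ** G)))\<^sup>2)) / 2" by simp
  also have "\<dots> = ((\<Sum>i<4. p i) * (norm G)\<^sup>2 - (\<Sum>i<4. p i * (cmod (trace (quat i ** G)))\<^sup>2)) / 2"
    by (simp add: sum_lt4 algebra_simps del: quat_entries)
  also have "\<dots> = (\<Sum>i<4. (1 / 2 - p i) * (cmod (trace (quat i ** G)))\<^sup>2) / 2"
    unfolding assms norm_sq_trace_quat by (simp add: left_diff_distrib sum_subtractf sum_divide_distrib)
  finally show ?thesis .
qed

lemma filter_overlap_le_half:
  assumes "(\<Sum>i<4. p i) = 1" "\<And>i. i < 4 \<Longrightarrow> p i \<le> 1 / 2"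
  shows "2 * filter_overlap p A B \<le> filter_mass p A B"
proof -
  have "0 \<le> (\<Sum>i<4. (1 / 2 - p i) * (cmod (trace (quat i ** (B ** dagger (adj2 A)))))\<^sup>2)"
    using assms by (intro sum_nonneg mult_nonneg_nonneg) auto
  then show ?thesis using filter_mass_minus_overlap[OF assms(1), of A B] by simp
qed

text \<open>The weighted mean of \<open>norm_sq_ge_det\<close> over the matrices
  \<open>A ** quat i ** B\<close>, whose determinants all have the same modulus. Equality of the
  means forces equality in every term of positive weight.\<close>

lemma filter_mass_ge_det:
  assumes "(\<Sum>i<4. p i) = 1" "\<And>i. i < 4 \<Longrightarrow> 0 \<le> p i"
  shows "cmod (det A) * cmod (det B) \<le> filter_mass p A B"
    and "filter_mass p A B = cmod (det A) * cmod (det B) \<Longrightarrow> i < 4 \<Longrightarrow> 0 < p i \<Longrightarrow>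
      (norm (A ** quat i ** B))\<^sup>2 = 2 * cmod (det (A ** quat i ** B))"
proof -
  let ?D = "cmod (det A) * cmod (det B)"
  let ?e = "\<lambda>i. (norm (A ** quat i ** B))\<^sup>2 - 2 * ?D"
  have d: "cmod (det (A ** quat i ** B)) = ?D" if "i < 4" for i
    using that by (simp add: det_mul norm_mult)
  then have n: "0 \<le> ?e i" if "i < 4" for i using norm_sq_ge_det[of "A ** quat i ** B"] that by simp
  have "(\<Sum>i<4. p i * ?e i) = (\<Sum>i<4. p i * (norm (A ** quat i ** B))\<^sup>2) - (\<Sum>i<4. p i) * (2 * ?D)"
    by (simp add: sum_distrib_right right_diff_distrib sum_subtractf)
  then have e: "(\<Sum>i<4. p i * ?e i) / 2 = filter_mass p A B - ?D"
    unfolding filter_mass_def assms by simp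
  have "0 \<le> (\<Sum>i<4. p i * ?e i)" using n assms by (intro sum_nonneg mult_nonneg_nonneg) auto
  then show "?D \<le> filter_mass p A B" using e by linarith
  assume "filter_mass p A B = ?D" "i < 4" "0 < p i"
  then have "(\<Sum>i<4. p i * ?e i) = 0" using e by simp
  then have "p i * ?e i = 0"
    using sum_nonneg_eq_0_iff[of "{..<4}" "\<lambda>i. p i * ?e i"] n assms \<open>i < 4\<close> by auto
  then show "(norm (A ** quat i ** B))\<^sup>2 = 2 * cmod (det (A ** quat i ** B))"
    using d \<open>i < 4\<close> \<open>0 < p i\<close> by simp
qed

lemma det_adj2: "det (adj2 A) = det A" "det (dagger A) = cnj (det A)" for A :: qubit_op
  by (simp_all add: mat2_simps mult_ac)

text \<open>Only the coefficient of index \<open>k\<close> in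
  \<open>filter_mass_minus_overlap\<close> can be negative. By \<open>det_trace_quat\<close>,
  \<open>\<tau> k\<close> is at most four times the determinant modulus plus the other
  \<open>\<tau> i\<close>. These others are compensated because \<open>p i + p k\<close> is at most
  1, hence \<open>p k - 1 / 2\<close> is at most \<open>1 / 2 - p i\<close>.\<close>

lemma filter_overlap_bound:
  assumes p: "(\<Sum>i<4. p i) = 1" "\<And>i. i < 4 \<Longrightarrow> 0 \<le> p i" and k: "k < 4" "1 / 2 \<le> p k"
  shows "(2 * p k - 1) * (filter_mass p A B - cmod (det A) * cmod (det B))
    \<le> 2 * (p k * filter_mass p A B - filter_overlap p A B)"
proof -
  define G where "G = B ** dagger (adj2 A)"
  define \<tau> where "\<tau> i = (cmod (trace (quat i ** G)))\<^sup>2" for i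
  have \<tau>: "0 \<le> \<tau> i" for i by (simp add: \<tau>_def)
  have dG: "cmod (det G) = cmod (det A) * cmod (det B)"
    by (simp add: G_def det_mul det_adj2 norm_mult)
  have "(trace (quat k ** G))\<^sup>2 = 4 * det G - (\<Sum>i\<in>{..<4} - {k}. (trace (quat i ** G))\<^sup>2)"
    unfolding det_trace_quat using k by (simp add: sum_diff1)
  then have "\<tau> k \<le> cmod (4 * det G) + cmod (\<Sum>i\<in>{..<4} - {k}. (trace (quat i ** G))\<^sup>2)"
    unfolding \<tau>_def norm_power[symmetric] by (simp only: norm_triangle_ineq4)
  also have "cmod (\<Sum>i\<in>{..<4} - {k}. (trace (quat i ** G))\<^sup>2) \<le> (\<Sum>i\<in>{..<4} - {k}. \<tau> i)"
    unfolding \<tau>_def norm_power[symmetric] by (rule norm_sum)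
  finally have tk: "\<tau> k \<le> 4 * (cmod (det A) * cmod (det B)) + (\<Sum>i\<in>{..<4} - {k}. \<tau> i)"
    by (simp add: norm_mult dG)
  have "(p k - 1 / 2) * (\<Sum>i\<in>{..<4} - {k}. \<tau> i) \<le> (\<Sum>i\<in>{..<4} - {k}. (1 / 2 - p i) * \<tau> i)"
    unfolding sum_distrib_left
  proof (rule sum_mono)
    fix i assume i: "i \<in> {..<4} - {k}"
    have "p i + p k = sum p {i, k}" using i by simp
    also have "\<dots> \<le> (\<Sum>i<4. p i)" using i k p(2) by (intro sum_mono2) auto
    finally have "p k - 1 / 2 \<le> 1 / 2 - p i" using p(1) by simp
    then show "(p k - 1 / 2) * \<tau> i \<le> (1 / 2 - p i) * \<tau> i" by (intro mult_right_mono \<tau>)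
  qed
  moreover have "(\<Sum>i<4. (1 / 2 - p i) * \<tau> i) = (\<Sum>i\<in>{..<4} - {k}. (1 / 2 - p i) * \<tau> i) + (1 / 2 - p k) * \<tau> k"
    using k by (simp add: sum_diff1)
  moreover have "(p k - 1 / 2) * \<tau> k \<le> (p k - 1 / 2) * (4 * (cmod (det A) * cmod (det B)) + (\<Sum>i\<in>{..<4} - {k}. \<tau> i))"
    using k tk by (intro mult_left_mono) auto
  ultimately have "- (p k - 1 / 2) * 4 * (cmod (det A) * cmod (det B)) \<le> (\<Sum>i<4. (1 / 2 - p i) * \<tau> i)"
    by (simp add: algebra_simps)
  then show ?thesis
    using filter_mass_minus_overlap[OF p(1), of A B] unfolding \<tau>_def G_def by (simp add: algebra_simps)
qed

lemma success_prob_form: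
  "success_prob A B M = Re (\<Sum>i<4. form M (pull A B (quat i)) (pull A B (quat i))) / 2"
  unfolding success_prob_def trace_form form_conjugate by simp

lemma success_prob_quat_diagonal:
  assumes "quat_diagonal M"
  shows "success_prob A B M = filter_mass (weight M) A (transpose B)"
proof -
  let ?X = "\<lambda>i. A ** quat i ** transpose B"
  have f: "Re (form M (pull A B (quat j)) (pull A B (quat j))) = (\<Sum>i<4. weight M i * (cmod (hs (quat j) (?X i)))\<^sup>2) / 2" for j
  proof -
    have "cnj (hs (?X i) (quat j)) * hs (?X i) (quat j) = of_real ((cmod (hs (quat j) (?X i)))\<^sup>2)" for i
      unfolding hs_cnj[of "?X i" "quat j"] complex_norm_square by simp
    then have "form M (pull A B (quat j)) (pull A B (quat j)) = of_real ((\<Sum>i<4. weight M i * (cmod (hs (quat j) (?X i)))\<^sup>2) / 2)"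
      unfolding form_quat_diagonal[OF assms] hs_pull by (simp add: mult.assoc)
    then show ?thesis by (simp only: Re_complex_of_real)
  qed
  have "success_prob A B M = (\<Sum>j<4. \<Sum>i<4. weight M i * (cmod (hs (quat j) (?X i)))\<^sup>2) / 4"
    unfolding success_prob_form Re_sum f by (simp add: sum_divide_distrib[symmetric])
  also have "\<dots> = (\<Sum>i<4. weight M i * (\<Sum>j<4. (cmod (hs (quat j) (?X i)))\<^sup>2)) / 4"
    by (subst sum.swap) (simp add: sum_distrib_left)
  also have "\<dots> = filter_mass (weight M) A (transpose B)"
    unfolding filter_mass_def norm_sq_parseval by (simp add: sum_divide_distrib[symmetric])
  finally show ?thesis .
qed

lemma overlap_quat_diagonal:
  assumes "quat_diagonal M"
  shows "Re (form M (pull A B W) (pull A B W)) / 2 = filter_overlap (weight M) (dagger W ** A) (transpose B)"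
proof -
  let ?X = "\<lambda>i. A ** quat i ** transpose B"
  have "cnj (hs (?X i) W) * hs (?X i) W = of_real ((cmod (trace (dagger W ** A ** quat i ** transpose B)))\<^sup>2)" for i
    unfolding hs_cnj[of "?X i" W] complex_norm_square by (simp add: hs_trace matrix_mul_assoc)
  then have "form M (pull A B W) (pull A B W) / 2 = of_real (filter_overlap (weight M) (dagger W ** A) (transpose B))"
    unfolding form_quat_diagonal[OF assms] hs_pull filter_overlap_def by (simp add: mult.assoc)
  then show ?thesis by (metis Re_complex_of_real Re_divide_numeral)
qed

section \<open>The equality case: from scaled unitaries to local unitaries\<close>

lemma adj2_mult: "adj2 X ** X = mat (det X)" "X ** adj2 X = mat (det X)"
  by (simp_all add: mat2_simps algebra_simps)

lemma mat_mult_mat: "mat a ** mat b = (mat (a * b) :: qubit_op)"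
  by (simp add: mat2_simps)

lemma mat_commute: "X ** mat c = mat c ** X" for X :: qubit_op
  by (simp add: mat2_simps mult.commute)

lemma mat_assoc: "mat a ** (mat b ** X) = mat (a * b) ** X" for X :: qubit_op
  by (simp add: matrix_mul_assoc mat_mult_mat)

lemma scale_dagger: "(mat a ** X) ** dagger (mat b ** Y) = mat (a * cnj b) ** (X ** dagger Y)"
  for X Y :: qubit_op
  by (simp add: mat2_simps algebra_simps)

lemma scale_right: "X ** (mat c ** Y) = mat c ** (X ** Y)" for X Y :: qubit_op
  by (metis mat_commute matrix_mul_assoc)

lemma matrix_add_rdist: "(X + Y) ** Z = X ** Z + Y ** Z" for X Y Z :: qubit_op
  by (simp add: mat2_simps algebra_simps)

lemma dagger_mat [simp]: "dagger (mat c) = (mat (cnj c) :: qubit_op)"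
  by (simp add: mat2_simps)

text \<open>With \<open>u\<close> the phase of the determinant and \<open>Y\<close> the matrix
  \<open>mat u ** dagger (adj2 X)\<close>, the squared norm of \<open>X - Y\<close> is twice the
  deficit in \<open>norm_sq_ge_det\<close>. So \<open>X = Y\<close>, and
  \<open>X ** dagger Y\<close> is scalar by the adjugate identity.\<close>

lemma norm_sq_det_imp_unitary:
  fixes X :: qubit_op
  assumes "(norm X)\<^sup>2 = 2 * cmod (det X)"
  shows "X ** dagger X = mat (of_real (cmod (det X)))"
proof (cases "det X = 0")
  case True
  with assms show ?thesis by (simp add: mat2_simps)
next
  case False
  define u where "u = det X / of_real (cmod (det X))"
  have u: "cmod u = 1" using False by (simp add: u_def norm_divide)
  then have uu: "u * cnj u = 1" by (simp add: complex_norm_square[symmetric])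
  define Y where "Y = mat u ** dagger (adj2 X)"
  have ny: "hs Y Y = hs X X"
  proof -
    have "hs Y Y = (u * cnj u) * hs X X" by (simp add: Y_def mat2_simps algebra_simps)
    then show ?thesis by (simp add: uu)
  qed
  have xy: "hs Y X = 2 * (cnj u * det X)" by (simp add: Y_def mat2_simps algebra_simps)
  have cu: "cnj u * det X = of_real (cmod (det X))"
    using False by (simp add: u_def complex_norm_square[symmetric] mult.commute[of "cnj _"] power2_eq_square)
  have "hs (X - Y) (X - Y) = hs X X + hs Y Y - hs Y X - cnj (hs Y X)"
    by (simp add: mat2_simps algebra_simps)
  also have "\<dots> = 0"
    unfolding ny xy cu hs_self[of X] using assms by simp
  finally have XY: "X = Y" by (simp add: hs_self)
  have "X ** dagger X = X ** dagger Y" using XY by simp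
  also have "\<dots> = mat (cnj u) ** (X ** adj2 X)"
    using scale_dagger[of 1 X u "dagger (adj2 X)"] by (simp add: Y_def)
  also have "\<dots> = mat (of_real (cmod (det X)))" by (simp add: adj2_mult mat_mult_mat cu)
  finally show ?thesis .
qed

lemma unitary_if_left: "X ** dagger X = mat 1 \<Longrightarrow> unitary X" for X :: qubit_op
  by (simp add: unitary_def matrix_left_right_inverse)

lemma scaled_unitary:
  fixes X :: qubit_op
  assumes "X ** dagger X = mat (of_real r)" "r > 0"
  shows "unitary (mat (of_real (1 / sqrt r)) ** X)"
proof (rule unitary_if_left)
  let ?c = "of_real (1 / sqrt r) :: complex"
  have "(mat ?c ** X) ** dagger (mat ?c ** X) = mat (?c * ?c) ** (X ** dagger X)"
    by (simp only: scale_dagger complex_cnj_complex_of_real)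
  also have "\<dots> = mat (?c * ?c * of_real r)" by (simp add: assms mat_mult_mat)
  also have "?c * ?c * of_real r = 1"
    using assms(2) by (simp flip: of_real_mult)
  finally show "(mat ?c ** X) ** dagger (mat ?c ** X) = mat 1" .
qed

text \<open>The unitary factor \<open>V\<close> of the polar decomposition of an invertible \<open>A\<close> is a multiple
  of \<open>A + u (adj A)\<^sup>*\<close>, where \<open>u\<close> is the phase of \<open>det A\<close>.  If \<open>A N A\<^sup>-\<^sup>1\<close> is unitary,
  then \<open>A N A\<^sup>-\<^sup>1\<close> equals its inverse adjoint, hence conjugation by \<open>V\<close> has the same effect on \<open>N\<close>.\<close>

lemma polar_unitary:
  fixes A :: qubit_op
  assumes "det A \<noteq> 0"
  obtains V where "unitary V"
    "\<And>N Y. unitary N \<Longrightarrow> unitary Y \<Longrightarrow> Y ** A = A ** N \<Longrightarrow> Y ** V = V ** N"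
proof -
  define u where "u = det A / of_real (cmod (det A))"
  have uu: "u * cnj u = 1" using assms
    by (simp add: u_def complex_norm_square[symmetric] power2_eq_square)
  have cu: "cnj u * det A = of_real (cmod (det A))"
    using assms by (simp add: u_def complex_norm_square[symmetric] mult.commute[of "cnj _"] power2_eq_square)
  define B where "B = dagger (adj2 A)"
  define V where "V = A + mat u ** B"
  \<comment> \<open>\<open>V\<close> is a fixed point of the map sending \<open>X\<close> to
    \<open>mat u ** dagger (adj2 X)\<close>, which makes \<open>V ** dagger V\<close>
    scalar.\<close>
  have s: "V = mat u ** dagger (adj2 V)"
  proof -
    have "mat u ** dagger (adj2 V) = mat u ** B + mat (u * cnj u) ** A"
      by (simp add: V_def B_def mat2_simps algebra_simps)
    then show ?thesis by (simp add: uu V_def add.commute)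
  qed
  have "V ** dagger V = V ** dagger (mat u ** dagger (adj2 V))" using s by simp
  also have "\<dots> = mat (cnj u * det V)"
    using scale_dagger[of 1 V u "dagger (adj2 V)"] by (simp add: adj2_mult mat_mult_mat)
  finally have vv: "V ** dagger V = mat (cnj u * det V)" .
  have "hs V V = trace (V ** dagger V)" by (simp add: mat2_simps algebra_simps)
  then have "of_real ((norm V)\<^sup>2) = 2 * (cnj u * det V)" unfolding vv hs_self by (simp add: trace_def mat_def)
  then have r: "cnj u * det V = of_real ((norm V)\<^sup>2 / 2)" by simp
  \<comment> \<open>A positive overlap with \<open>A\<close> shows that \<open>V\<close> is nonzero
    and can be normalised.\<close>
  have "hs A V = hs A A + u * cnj (2 * det A)"
    by (simp add: V_def B_def mat2_simps algebra_simps)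
  also have "u * cnj (2 * det A) = 2 * cnj (cnj u * det A)" by simp
  finally have "hs A V = of_real ((norm A)\<^sup>2 + 2 * cmod (det A))" by (simp only: cu hs_self) simp
  moreover have "(norm A)\<^sup>2 + 2 * cmod (det A) > 0" using assms by (simp add: add_nonneg_pos)
  ultimately have "hs A V \<noteq> 0" by (metis of_real_eq_0_iff less_irrefl)
  then have "V \<noteq> 0" by (auto simp: hs_def)
  then have pos: "(norm V)\<^sup>2 / 2 > 0" by simp
  define c :: complex where "c = of_real (1 / sqrt ((norm V)\<^sup>2 / 2))"
  have "unitary (mat c ** V)" unfolding c_def by (rule scaled_unitary[OF _ pos]) (simp only: vv r)
  moreover have "Y ** (mat c ** V) = (mat c ** V) ** N"
    if "unitary N" "unitary Y" "Y ** A = A ** N" for N Y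
  proof -
    \<comment> \<open>Up to a scalar, \<open>B\<close> is the inverse of
      \<open>dagger A\<close>.\<close>
    have ab: "dagger A ** B = mat (cnj (det A))" "B ** dagger A = mat (cnj (det A))"
      by (metis B_def dagger_mult adj2_mult dagger_mat)+
    have "dagger (Y ** A) = dagger (A ** N)" using that by simp
    then have d: "dagger A ** dagger Y = dagger N ** dagger A" by (simp add: dagger_mult)
    have yy: "dagger Y ** Y = mat 1" and nn: "N ** dagger N = mat 1" using that by (simp_all add: unitary_def)
    have "N ** dagger A = N ** (dagger A ** (dagger Y ** Y))" by (simp add: yy)
    also have "\<dots> = N ** ((dagger A ** dagger Y) ** Y)" by (simp only: matrix_mul_assoc)
    also have "\<dots> = (N ** dagger N) ** (dagger A ** Y)" unfolding d by (simp only: matrix_mul_assoc)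
    finally have na: "N ** dagger A = dagger A ** Y" by (simp add: nn)
    have "B ** (N ** dagger A) ** B = B ** (dagger A ** Y) ** B" by (simp add: na)
    then have "B ** N ** mat (cnj (det A)) = mat (cnj (det A)) ** (Y ** B)"
      by (metis ab matrix_mul_assoc)
    then have "mat (cnj (det A)) ** (B ** N) = mat (cnj (det A)) ** (Y ** B)" by (simp add: mat_commute)
    then have "mat (inverse (cnj (det A)) * cnj (det A)) ** (B ** N) = mat (inverse (cnj (det A)) * cnj (det A)) ** (Y ** B)"
      by (metis mat_assoc)
    then have yb: "B ** N = Y ** B" using assms by simp
    have "Y ** V = V ** N"
      unfolding V_def matrix_add_ldistrib matrix_add_rdist that(3) by (metis mat_commute matrix_mul_assoc yb)
    then show ?thesis by (metis mat_commute matrix_mul_assoc)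
  qed
  ultimately show thesis using that by blast
qed

text \<open>Normalised, the matrices \<open>A ** quat i ** B\<close> are unitary, and their
  quotients are conjugates by \<open>A\<close> of the unitaries
  \<open>quat i ** dagger (quat k)\<close>. By \<open>polar_unitary\<close> the polar factor
  \<open>U\<close> of \<open>A\<close> conjugates these in the same way, so one pair
  \<open>U\<close>, \<open>V\<close> serves all indices in \<open>P\<close>.\<close>

lemma unitary_conjugates:
  fixes A B :: qubit_op and P :: "nat set"
  defines "D \<equiv> cmod (det A) * cmod (det B)"
  assumes "D > 0" and P: "P \<subseteq> {..<4}"
    and n: "\<And>i. i \<in> P \<Longrightarrow> (norm (A ** quat i ** B))\<^sup>2 = 2 * cmod (det (A ** quat i ** B))"
  obtains U V where "unitary U" "unitary V"
    "\<And>i. i \<in> P \<Longrightarrow> A ** quat i ** B = mat (of_real (sqrt D)) ** (U ** quat i ** V)"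
proof (cases "P = {}")
  case True
  then show ?thesis using that unitary_one by blast
next
  case False
  then obtain k where k: "k \<in> P" by blast
  define X where "X i = A ** quat i ** B" for i
  define r :: complex where "r = of_real (1 / sqrt D)"
  define Z where "Z i = mat r ** X i" for i
  have dX: "cmod (det (X i)) = D" if "i \<in> P" for i
    using that P by (auto simp: X_def det_mul norm_mult D_def)
  have Z: "unitary (Z i)" if "i \<in> P" for i
    unfolding Z_def r_def
    using scaled_unitary[OF _ \<open>D > 0\<close>] norm_sq_det_imp_unitary[OF n[OF that]] dX[OF that]
    unfolding X_def by simp
  have dA: "det A \<noteq> 0" using \<open>D > 0\<close> by (auto simp: D_def)
  then obtain U where U: "unitary U"
    "\<And>N Y. unitary N \<Longrightarrow> unitary Y \<Longrightarrow> Y ** A = A ** N \<Longrightarrow> Y ** U = U ** N"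
    using polar_unitary by blast
  \<comment> \<open>The only choice satisfying the claim at the reference index
    \<open>k\<close>.\<close>
  define V where "V = dagger (quat k) ** dagger U ** Z k"
  have uk: "unitary (quat k)" using k P by auto
  have V: "unitary V" unfolding V_def by (intro unitary_mult unitary_dagger uk U Z k)
  have "X i = mat (of_real (sqrt D)) ** (U ** quat i ** V)" if i: "i \<in> P" for i
  proof -
    define N where "N = quat i ** dagger (quat k)"
    define Y where "Y = Z i ** dagger (Z k)"
    have ui: "unitary (quat i)" using i P by auto
    have N: "unitary N" unfolding N_def by (intro unitary_mult unitary_dagger ui uk)
    have Y: "unitary Y" unfolding Y_def by (intro unitary_mult unitary_dagger Z i k)
    have Nk: "N ** quat k = quat i"
      using uk by (simp add: N_def unitary_def matrix_mul_assoc[symmetric])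
    have "Y ** Z k = Z i"
      using Z[OF k] by (simp add: Y_def unitary_def matrix_mul_assoc[symmetric])
    then have "mat r ** (Y ** X k) = mat r ** X i"
      unfolding Z_def by (metis mat_commute matrix_mul_assoc)
    then have "mat (of_real (sqrt D) * r) ** (Y ** X k) = mat (of_real (sqrt D) * r) ** X i" by (metis mat_assoc)
    moreover have r1: "of_real (sqrt D) * r = 1" using \<open>D > 0\<close> by (simp add: r_def flip: of_real_mult)
    ultimately have "Y ** X k = X i" by simp
    then have "Y ** A ** (quat k ** B) = A ** N ** (quat k ** B)"
      unfolding X_def by (metis Nk matrix_mul_assoc)
    moreover have "det (quat k ** B) \<noteq> 0" using k P \<open>D > 0\<close> by (auto simp: det_mul D_def)
    then obtain E where "quat k ** B ** E = mat 1"
      by (metis invertible_det_nz invertible_right_inverse)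
    ultimately have "Y ** A = A ** N" by (metis matrix_mul_assoc matrix_mul_rid)
    then have YU: "Y ** U = U ** N" using U(2) N Y by blast
    have "U ** quat i ** V = U ** N ** dagger U ** Z k"
      unfolding V_def N_def by (simp add: matrix_mul_assoc)
    also have "\<dots> = Y ** (U ** dagger U) ** Z k" by (simp add: YU[symmetric] matrix_mul_assoc)
    also have "\<dots> = Z i" using U(1) \<open>Y ** Z k = Z i\<close> by (simp add: unitary_def)
    finally show ?thesis by (simp add: Z_def mat_assoc r1)
  qed
  then show ?thesis using that U(1) V unfolding X_def by blast
qed

section \<open>Fidelity of filtered Bell-diagonal states\<close>

lemma form_filtered:
  "form (filtered A B M) X Y = form M (pull A B X) (pull A B Y) / of_real (success_prob A B M)"
  unfolding filtered_def form_scaleR form_conjugate by simp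

lemma success_prob_filtered:
  "success_prob A B (filtered A' B' M) = success_prob (A ** A') (B ** B') M / success_prob A' B' M"
  unfolding success_prob_form[of A B] success_prob_form[of "A ** A'"] form_filtered pull_mult
  by (simp add: sum_divide_distrib mult.commute)

lemma filtered_filtered:
  assumes "success_prob A' B' M \<noteq> 0"
  shows "filtered A B (filtered A' B' M) = filtered (A ** A') (B ** B') M"
  unfolding form_eq_iff form_filtered pull_mult success_prob_filtered using assms by simp

lemma bell_diagonal_weights:
  assumes "bell_diagonal M"
  shows "quat_diagonal M" "(\<Sum>i<4. weight M i) = 1" "0 \<le> weight M i"
proof -
  have s: "state M" and p: "pos_semidef M" and t: "trace M = 1"
    using assms by (simp_all add: bell_diagonal_iff state_def)
  show "quat_diagonal M" using assms p by (simp add: bell_diagonal_iff quat_diagonal_def pos_semidef_def)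
  have "Re (trace M) = (\<Sum>i<4. weight M i)"
    unfolding trace_form weight_def by (simp add: sum_divide_distrib)
  then show "(\<Sum>i<4. weight M i) = 1" using t by simp
  show "0 \<le> weight M i" using psd_form_nonneg[OF p] by (simp add: weight_def)
qed

lemma filter_mass_unitary: "unitary W \<Longrightarrow> filter_mass p (W ** A) B = filter_mass p A B"
  unfolding filter_mass_def by (metis (no_types, lifting) matrix_mul_assoc norm_unitary_mult)

lemma cmod_det_unitary: "unitary W \<Longrightarrow> cmod (det W) = 1" for W :: qubit_op
proof -
  assume "unitary W"
  then have "cnj (det W) * det W = 1" unfolding unitary_def by (metis det_I det_adj2(2) det_mul)
  then have "(cmod (det W))\<^sup>2 = 1"
    by (metis complex_norm_square mult.commute of_real_eq_1_iff)
  then show ?thesis by (simp add: power2_eq_1_iff) (smt (verit) norm_ge_zero)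
qed

text \<open>The adjoint of the maximising unitary is absorbed into the first filter, so only the
  overlap with the vector of \<open>mat 1\<close> remains.\<close>

lemma fidelity_filtered_bell:
  assumes "bell_diagonal M"
  obtains W where "unitary W" "fidelity (filtered A B M)
     = filter_overlap (weight M) (W ** A) (transpose B) / success_prob A B M"
proof -
  obtain W where W: "unitary W" "fidelity (filtered A B M) = Re (form (filtered A B M) W W) / 2"
    by (rule fidelity_attained)
  have "fidelity (filtered A B M) = Re (form M (pull A B W) (pull A B W)) / 2 / success_prob A B M"
    unfolding W(2) form_filtered by simp
  then show thesis
    using that[OF unitary_dagger[OF W(1)]] overlap_quat_diagonal[OF bell_diagonal_weights(1)[OF assms]] by simp
qed

lemma fidelity_filtered_bell_le_half:
  assumes "bell_diagonal M" "\<And>i. i < 4 \<Longrightarrow> weight M i \<le> 1 / 2" "0 < success_prob A B M"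
  shows "fidelity (filtered A B M) \<le> 1 / 2"
proof -
  note b = bell_diagonal_weights[OF assms(1)]
  obtain W where W: "unitary W" "fidelity (filtered A B M)
     = filter_overlap (weight M) (W ** A) (transpose B) / success_prob A B M"
    using fidelity_filtered_bell[OF assms(1)] by blast
  have "2 * filter_overlap (weight M) (W ** A) (transpose B) \<le> success_prob A B M"
    using filter_overlap_le_half[OF b(2) assms(2)] filter_mass_unitary[OF W(1)]
      success_prob_quat_diagonal[OF b(1)] by metis
  then show ?thesis unfolding W(2) using assms(3) by (simp add: field_simps)
qed

text \<open>Both sides of \<open>filter_overlap_bound\<close> are nonnegative here. If the fidelity
  reaches \<open>weight M k\<close>, the right side vanishes, and the positive factor
  \<open>2 * weight M k - 1\<close> forces the determinant bound to be tight.\<close>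

lemma fidelity_filtered_bell_le:
  assumes "bell_diagonal M" "k < 4" "1 / 2 < weight M k" "0 < success_prob A B M"
  shows "fidelity (filtered A B M) \<le> weight M k"
    and "fidelity (filtered A B M) = weight M k \<Longrightarrow>
      filter_mass (weight M) A (transpose B) = cmod (det A) * cmod (det (transpose B))"
proof -
  note b = bell_diagonal_weights[OF assms(1)]
  let ?S = "success_prob A B M" let ?D = "cmod (det A) * cmod (det (transpose B))"
  obtain W where W: "unitary W" "fidelity (filtered A B M)
     = filter_overlap (weight M) (W ** A) (transpose B) / ?S"
    using fidelity_filtered_bell[OF assms(1)] by blast
  have S: "filter_mass (weight M) (W ** A) (transpose B) = ?S" "filter_mass (weight M) A (transpose B) = ?S"
    using filter_mass_unitary[OF W(1)] success_prob_quat_diagonal[OF b(1)] by simp_all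
  have D: "cmod (det (W ** A)) = cmod (det A)" by (simp add: det_mul norm_mult cmod_det_unitary[OF W(1)])
  have le: "(2 * weight M k - 1) * (?S - ?D) \<le> 2 * (weight M k * ?S - filter_overlap (weight M) (W ** A) (transpose B))"
    using filter_overlap_bound[OF b(2,3) assms(2), of "W ** A" "transpose B"] assms(3) unfolding S D by simp
  have ge: "?D \<le> ?S" using filter_mass_ge_det(1)[OF b(2,3), of A "transpose B"] unfolding S by simp
  have "0 \<le> (2 * weight M k - 1) * (?S - ?D)" using ge assms(3) by simp
  then have "0 \<le> 2 * (weight M k * ?S - filter_overlap (weight M) (W ** A) (transpose B))"
    using le by (rule order_trans)
  then have "filter_overlap (weight M) (W ** A) (transpose B) \<le> weight M k * ?S" by simp
  then show "fidelity (filtered A B M) \<le> weight M k" unfolding W(2) using assms(4) by (simp add: field_simps)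
  assume "fidelity (filtered A B M) = weight M k"
  then have "filter_overlap (weight M) (W ** A) (transpose B) = weight M k * ?S"
    unfolding W(2) using assms(4) by (simp add: field_simps)
  then have "(2 * weight M k - 1) * (?S - ?D) \<le> 0" using le by simp
  then have "?S \<le> ?D" using assms(3) by (simp add: mult_le_0_iff)
  then show "filter_mass (weight M) A (transpose B) = ?D" using ge S by simp
qed

lemma locally_unitarily_equivalent_iff:
  "locally_unitarily_equivalent M N \<longleftrightarrow>
    (\<exists>U V. unitary U \<and> unitary V \<and> (\<forall>X Y. form N X Y = form M (pull U V X) (pull U V Y)))"
  unfolding locally_unitarily_equivalent_def form_eq_iff form_conjugate by blast

lemma unitary_pull: "unitary U \<Longrightarrow> unitary V \<Longrightarrow> unitary W \<Longrightarrow> unitary (pull U V W)"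
  unfolding pull_def by (intro unitary_mult unitary_dagger unitary_conj_op)

lemma locally_unitarily_equivalent_sym:
  assumes "locally_unitarily_equivalent M N" shows "locally_unitarily_equivalent N M"
proof -
  obtain U V where UV: "unitary U" "unitary V" "\<And>X Y. form N X Y = form M (pull U V X) (pull U V Y)"
    using assms unfolding locally_unitarily_equivalent_iff by blast
  have "pull U V (pull (dagger U) (dagger V) X) = X" for X
    unfolding pull_mult[symmetric] using UV by (simp add: unitary_def)
  then have "form M X Y = form N (pull (dagger U) (dagger V) X) (pull (dagger U) (dagger V) Y)" for X Y
    using UV(3) by simp
  then show ?thesis unfolding locally_unitarily_equivalent_iff using UV unitary_dagger by blast
qed

lemma fidelity_mono_local_unitary:
  "locally_unitarily_equivalent M N \<Longrightarrow> fidelity N \<le> fidelity M"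
  unfolding locally_unitarily_equivalent_iff
  by (metis fidelity_attained fidelity_ge unitary_pull)

lemma fidelity_local_unitary:
  "locally_unitarily_equivalent M N \<Longrightarrow> fidelity N = fidelity M"
  by (meson fidelity_mono_local_unitary locally_unitarily_equivalent_sym order_antisym)

lemma hs_scale_left: "hs (mat c ** X) Y = cnj c * hs X Y"
  by (simp add: mat2_simps algebra_simps)

text \<open>Equality makes \<open>unitary_conjugates\<close> applicable: up to one common factor,
  which is the success probability, the filters move every Bell vector of positive weight as local
  unitaries do.\<close>

lemma fidelity_filtered_bell_eq:
  assumes "bell_diagonal M" "k < 4" "1 / 2 < weight M k" "0 < success_prob A B M"
    and "fidelity (filtered A B M) = weight M k"
  shows "locally_unitarily_equivalent (filtered A B M) M"
proof -
  note b = bell_diagonal_weights[OF assms(1)]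
  let ?D = "cmod (det A) * cmod (det (transpose B))"
  \<comment> \<open>Bell vectors of weight zero are left out: they contribute nothing to the output,
    and equality gives no information on them.\<close>
  define P where "P = {i. i < 4 \<and> 0 < weight M i}"
  have S: "filter_mass (weight M) A (transpose B) = ?D"
    using fidelity_filtered_bell_le(2)[OF assms] .
  then have SD: "success_prob A B M = ?D" using success_prob_quat_diagonal[OF b(1)] by simp
  obtain U V where UV: "unitary U" "unitary V" and
    c: "\<And>i. i \<in> P \<Longrightarrow> A ** quat i ** transpose B = mat (of_real (sqrt ?D)) ** (U ** quat i ** V)"
    using unitary_conjugates[of A "transpose B" P] filter_mass_ge_det(2)[OF b(2,3) S] SD assms(4)
    unfolding P_def by (smt (verit, best) lessThan_iff mem_Collect_eq subsetI)
  have "form (filtered A B M) X Y = form M (pull U (transpose V) X) (pull U (transpose V) Y)" for X Y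
  proof -
    have e: "of_real (weight M i) * cnj (hs (A ** quat i ** transpose B) X) * hs (A ** quat i ** transpose B) Y
       = of_real ?D * (of_real (weight M i) * cnj (hs (U ** quat i ** V) X) * hs (U ** quat i ** V) Y)"
      if "i < 4" for i
    proof (cases "weight M i = 0")
      case False
      then have "i \<in> P" using that b(3)[of i] by (simp add: P_def)
      have "of_real (sqrt ?D) * of_real (sqrt ?D) = (of_real ?D :: complex)"
        by (simp only: of_real_mult[symmetric]) simp
      then show ?thesis unfolding c[OF \<open>i \<in> P\<close>] hs_scale_left by (simp add: mult_ac)
    qed simp
    have "form M (pull A B X) (pull A B Y)
      = of_real ?D * form M (pull U (transpose V) X) (pull U (transpose V) Y)"
      unfolding form_quat_diagonal[OF b(1)] hs_pull times_divide_eq_right sum_distrib_left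
      by (intro arg_cong[where f = "\<lambda>x. x / 2"] sum.cong refl)
         (simp only: lessThan_iff transpose_transpose e)
    moreover have "of_real ?D \<noteq> (0 :: complex)" using assms(4) SD by (metis of_real_eq_0_iff less_irrefl)
    ultimately show ?thesis unfolding form_filtered SD by simp
  qed
  then have "locally_unitarily_equivalent M (filtered A B M)"
    unfolding locally_unitarily_equivalent_iff using UV unitary_transpose by blast
  then show ?thesis by (rule locally_unitarily_equivalent_sym)
qed

section \<open>First-order conditions over local filters\<close>

text \<open>Kept unnormalised, so that along filters affine in a real parameter it is a quadratic
  polynomial; a constant \<open>d\<close> of value 1/2 gives the success probability.\<close>

definition cost :: "(nat \<Rightarrow> real) \<Rightarrow> two_qubit_op \<Rightarrow> qubit_op \<Rightarrow> qubit_op \<Rightarrow> real" where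
  "cost d M A B = (\<Sum>i<4. d i * Re (form M (pull A B (quat i)) (pull A B (quat i))))"

lemma linear_coeff_eq_0:
  fixes b c :: real
  assumes "\<And>t. 0 \<le> b * t + c * t\<^sup>2"
  shows "b = 0"
proof (rule ccontr)
  assume "b \<noteq> 0"
  \<comment> \<open>At the argument \<open>- b / s\<close> the linear term outweighs the quadratic
    one, since \<open>s\<close> exceeds the modulus of \<open>c\<close>.\<close>
  define s where "s = \<bar>c\<bar> + 1"
  have s: "s > 0" "\<bar>c\<bar> < s" by (auto simp: s_def)
  have "0 \<le> b * (- b / s) + c * (- b / s)\<^sup>2" by (rule assms)
  also have "\<dots> = b\<^sup>2 / s * (c / s - 1)" using s by (simp add: field_simps power2_eq_square)
  also have "\<dots> < 0"
  proof (rule mult_pos_neg)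
    show "0 < b\<^sup>2 / s" using \<open>b \<noteq> 0\<close> s by simp
    have "c / s < 1" using s by (simp add: divide_less_eq)
    then show "c / s - 1 < 0" by simp
  qed
  finally show False by simp
qed

text \<open>The cost is quadratic in \<open>t\<close>, and its linear coefficient is twice the sum
  in question. The slack \<open>K * t\<^sup>2\<close> absorbs second-order changes of a determinant
  or norm, so the perturbed filters need not be normalised.\<close>

lemma stationary:
  assumes "dagger M = M"
    and p: "\<And>t X. pull (A t) (B t) X = X + mat (of_real t) ** f X"
    and le: "\<And>t. cost d M (mat 1) (mat 1) \<le> cost d M (A t) (B t) + K * t\<^sup>2"
  shows "(\<Sum>i<4. d i * Re (form M (quat i) (f (quat i)))) = 0"
proof -
  let ?L = "\<Sum>i<4. d i * Re (form M (quat i) (f (quat i)))"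
  let ?Q = "\<Sum>i<4. d i * Re (form M (f (quat i)) (f (quat i)))"
  have "cost d M (A t) (B t) = cost d M (mat 1) (mat 1) + 2 * ?L * t + ?Q * t\<^sup>2" for t
  proof -
    have "Re (form M (pull (A t) (B t) X) (pull (A t) (B t) X))
      = Re (form M X X) + 2 * Re (form M X (f X)) * t + Re (form M (f X) (f X)) * t\<^sup>2" for X
      unfolding p form_add_left form_add_right form_scale_left form_scale_right
      by (simp add: form_hermitian[OF assms(1), of X "f X"] power2_eq_square algebra_simps)
    then show ?thesis unfolding cost_def
      by (simp add: algebra_simps sum.distrib sum_distrib_left del: quat_entries)
  qed
  then have "0 \<le> (2 * ?L) * t + (?Q + K) * t\<^sup>2" for t
    using le[of t] by (simp add: algebra_simps)
  then have "2 * ?L = 0" by (rule linear_coeff_eq_0)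
  then show ?thesis by simp
qed

lemma quat_mult:
  "quat 1 ** quat 1 = mat (-1) ** quat 0" "quat 2 ** quat 2 = mat (-1) ** quat 0" "quat 3 ** quat 3 = mat (-1) ** quat 0"
  "quat 1 ** quat 2 = mat (-1) ** quat 3" "quat 2 ** quat 1 = quat 3"
  "quat 2 ** quat 3 = mat (-1) ** quat 1" "quat 3 ** quat 2 = quat 1"
  "quat 3 ** quat 1 = mat (-1) ** quat 2" "quat 1 ** quat 3 = quat 2"
  "quat 0 ** quat k = quat k" "quat 1 ** quat 0 = quat 1" "quat 2 ** quat 0 = quat 2" "quat 3 ** quat 0 = quat 3"
  by (simp_all add: mat2_simps)

text \<open>Multiplication by \<open>quat k\<close> pairs 0 with \<open>k\<close> and the other two
  indices with each other. Left and right multiplication give the two pairs opposite relative signs,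
  so adding and subtracting the conditions separates them.\<close>

lemma stationary_quat_Re:
  assumes h: "dagger M = M"
    and l: "\<And>k. k \<in> {1, 2, 3} \<Longrightarrow> (\<Sum>i<4. d i * Re (form M (quat i) (quat k ** quat i))) = 0"
    and r: "\<And>k. k \<in> {1, 2, 3} \<Longrightarrow> (\<Sum>i<4. d i * Re (form M (quat i) (quat i ** quat k))) = 0"
    and ij: "i < 4" "j < 4" "i \<noteq> j"
  shows "(d i - d j) * Re (form M (quat i) (quat j)) = 0"
proof -
  let ?c = "\<lambda>i j. Re (form M (quat i) (quat j))"
  have s: "?c 1 0 = ?c 0 1" "?c 2 0 = ?c 0 2" "?c 3 0 = ?c 0 3" "?c 2 1 = ?c 1 2" "?c 3 1 = ?c 1 3" "?c 3 2 = ?c 2 3"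
    by (subst form_hermitian[OF h], simp del: quat_entries One_nat_def)+
  have "(d 0 - d 1) * ?c 0 1 - (d 2 - d 3) * ?c 2 3 = 0"
    using l[of 1] unfolding sum_lt4 quat_mult form_scale_right by (simp add: s algebra_simps del: quat_entries One_nat_def)
  moreover have "(d 0 - d 1) * ?c 0 1 + (d 2 - d 3) * ?c 2 3 = 0"
    using r[of 1] unfolding sum_lt4 quat_mult form_scale_right by (simp add: s algebra_simps del: quat_entries One_nat_def)
  ultimately have q1: "(d 0 - d 1) * ?c 0 1 = 0" "(d 2 - d 3) * ?c 2 3 = 0" by linarith+
  have "(d 0 - d 2) * ?c 0 2 + (d 1 - d 3) * ?c 1 3 = 0"
    using l[of 2] unfolding sum_lt4 quat_mult form_scale_right by (simp add: s algebra_simps del: quat_entries One_nat_def)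
  moreover have "(d 0 - d 2) * ?c 0 2 - (d 1 - d 3) * ?c 1 3 = 0"
    using r[of 2] unfolding sum_lt4 quat_mult form_scale_right by (simp add: s algebra_simps del: quat_entries One_nat_def)
  ultimately have q2: "(d 0 - d 2) * ?c 0 2 = 0" "(d 1 - d 3) * ?c 1 3 = 0" by linarith+
  have "(d 0 - d 3) * ?c 0 3 - (d 1 - d 2) * ?c 1 2 = 0"
    using l[of 3] unfolding sum_lt4 quat_mult form_scale_right by (simp add: s algebra_simps del: quat_entries One_nat_def)
  moreover have "(d 0 - d 3) * ?c 0 3 + (d 1 - d 2) * ?c 1 2 = 0"
    using r[of 3] unfolding sum_lt4 quat_mult form_scale_right by (simp add: s algebra_simps del: quat_entries One_nat_def)
  ultimately have q3: "(d 0 - d 3) * ?c 0 3 = 0" "(d 1 - d 2) * ?c 1 2 = 0" by linarith+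
  note q = q1 q2 q3
  have lt: "(d i - d j) * ?c i j = 0" if "i < j" "j < 4" for i j
  proof -
    have "(i, j) \<in> {(0,1), (0,2), (0,3), (1,2), (1,3), (2,3)}" using that by auto
    then show ?thesis using q by (elim insertE emptyE Pair_inject) (simp_all only:)
  qed
  show ?thesis
  proof (cases "i < j")
    case False
    then have "(d j - d i) * ?c j i = 0" using lt ij by simp
    moreover have "?c j i = ?c i j" by (subst form_hermitian[OF h]) simp
    moreover have "(d i - d j) * ?c i j = - ((d j - d i) * ?c i j)" by (simp add: algebra_simps)
    ultimately show ?thesis by simp
  qed (use lt ij in simp)
qed

text \<open>The same separation; imaginary parts of a Hermitian form are antisymmetric, which turns
  differences of weights into sums.\<close>

lemma stationary_quat_Im:
  assumes h: "dagger M = M"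
    and l: "\<And>k. k \<in> {1, 2, 3} \<Longrightarrow> (\<Sum>i<4. d i * Im (form M (quat i) (quat k ** quat i))) = 0"
    and r: "\<And>k. k \<in> {1, 2, 3} \<Longrightarrow> (\<Sum>i<4. d i * Im (form M (quat i) (quat i ** quat k))) = 0"
    and ij: "i < 4" "j < 4" "i \<noteq> j"
  shows "(d i + d j) * Im (form M (quat i) (quat j)) = 0"
proof -
  let ?c = "\<lambda>i j. Im (form M (quat i) (quat j))"
  have s: "?c 1 0 = - ?c 0 1" "?c 2 0 = - ?c 0 2" "?c 3 0 = - ?c 0 3" "?c 2 1 = - ?c 1 2" "?c 3 1 = - ?c 1 3" "?c 3 2 = - ?c 2 3"
    by (subst form_hermitian[OF h], simp del: quat_entries One_nat_def)+
  have "(d 0 + d 1) * ?c 0 1 - (d 2 + d 3) * ?c 2 3 = 0"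
    using l[of 1] unfolding sum_lt4 quat_mult form_scale_right by (simp add: s algebra_simps del: quat_entries One_nat_def)
  moreover have "(d 0 + d 1) * ?c 0 1 + (d 2 + d 3) * ?c 2 3 = 0"
    using r[of 1] unfolding sum_lt4 quat_mult form_scale_right by (simp add: s algebra_simps del: quat_entries One_nat_def)
  ultimately have q1: "(d 0 + d 1) * ?c 0 1 = 0" "(d 2 + d 3) * ?c 2 3 = 0" by linarith+
  have "(d 0 + d 2) * ?c 0 2 + (d 1 + d 3) * ?c 1 3 = 0"
    using l[of 2] unfolding sum_lt4 quat_mult form_scale_right by (simp add: s algebra_simps del: quat_entries One_nat_def)
  moreover have "(d 0 + d 2) * ?c 0 2 - (d 1 + d 3) * ?c 1 3 = 0"
    using r[of 2] unfolding sum_lt4 quat_mult form_scale_right by (simp add: s algebra_simps del: quat_entries One_nat_def)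
  ultimately have q2: "(d 0 + d 2) * ?c 0 2 = 0" "(d 1 + d 3) * ?c 1 3 = 0" by linarith+
  have "(d 0 + d 3) * ?c 0 3 - (d 1 + d 2) * ?c 1 2 = 0"
    using l[of 3] unfolding sum_lt4 quat_mult form_scale_right by (simp add: s algebra_simps del: quat_entries One_nat_def)
  moreover have "(d 0 + d 3) * ?c 0 3 + (d 1 + d 2) * ?c 1 2 = 0"
    using r[of 3] unfolding sum_lt4 quat_mult form_scale_right by (simp add: s algebra_simps del: quat_entries One_nat_def)
  ultimately have q3: "(d 0 + d 3) * ?c 0 3 = 0" "(d 1 + d 2) * ?c 1 2 = 0" by linarith+
  note q = q1 q2 q3
  have lt: "(d i + d j) * ?c i j = 0" if "i < j" "j < 4" for i j
  proof -
    have "(i, j) \<in> {(0,1), (0,2), (0,3), (1,2), (1,3), (2,3)}" using that by auto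
    then show ?thesis using q by (elim insertE emptyE Pair_inject) (simp_all only:)
  qed
  show ?thesis
  proof (cases "i < j")
    case False
    then have "(d j + d i) * ?c j i = 0" using lt ij by simp
    moreover have "?c j i = - ?c i j" by (subst form_hermitian[OF h]) simp
    ultimately show ?thesis by (auto simp: add.commute)
  qed (use lt ij in simp)
qed

section \<open>The cone of separable operators\<close>

definition projector :: "complex^'n \<Rightarrow> complex^'n^'n" where
  "projector v = (\<chi> i j. v $ i * cnj (v $ j))"

lemma braket_projector: "braket u (projector v *v w) = braket u v * braket v w"
  by (simp add: braket_def projector_def matrix_vector_mult_def sum_product sum_distrib_left mult_ac)
    (rule sum.swap)

lemma braket_self: "braket v v = of_real ((norm v)\<^sup>2)" for v :: "complex^'n"
proof -
  have "(norm v)\<^sup>2 = (\<Sum>i\<in>UNIV. (cmod (v $ i))\<^sup>2)"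
    unfolding norm_vec_def L2_set_def by (simp add: sum_nonneg)
  then show ?thesis
    by (simp add: braket_def complex_norm_square mult.commute[of "cnj _"] del: of_real_power)
qed

lemma braket_cnj: "braket v u = cnj (braket u v)"
  by (simp add: braket_def mult.commute)

lemma trace_projector: "trace (projector v) = of_real ((norm v)\<^sup>2)"
  unfolding braket_self[symmetric] by (simp add: trace_def projector_def braket_def mult.commute)

lemma state_projector:
  assumes "norm v = 1" shows "state (projector v)"
proof -
  have "0 \<le> Re (braket w (projector v *v w))" for w
    unfolding braket_projector braket_cnj[of v w] by (simp add: complex_mult_cnj)
  moreover have "dagger (projector v) = projector v"
    by (simp add: dagger_def transpose_def map_matrix_def projector_def vec_eq_iff)
  ultimately show ?thesis using assms by (simp add: state_def pos_semidef_def trace_projector)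
qed

lemma braket_vec_of: "braket (vec_of X) (vec_of Y) = hs X Y"
  by (simp add: braket_def sum_pair2) (simp add: mat2_simps add_ac)

lemma norm_vec_of: "norm (vec_of X) = norm X"
proof -
  have "(norm (vec_of X))\<^sup>2 = (norm X)\<^sup>2"
    by (metis braket_self braket_vec_of hs_self of_real_eq_iff)
  then show ?thesis by simp
qed

lemma form_projector: "form (projector (vec_of Z)) X Y = hs X Z * hs Z Y"
  by (simp add: form_def braket_projector braket_vec_of)

text \<open>A vector is a product exactly when its matrix is singular, so these are the pure product
  states, described by a closed condition that filters preserve.\<close>

definition pure_product :: "two_qubit_op set" where
  "pure_product = (\<lambda>Z. projector (vec_of Z)) ` {Z. det Z = 0 \<and> norm Z = 1}"

lemma det_zero_product:
  fixes Z :: qubit_op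
  assumes "det Z = 0" "norm Z = 1"
  obtains a b :: "complex^2" where "norm a = 1" "norm b = 1" "Z = (\<chi> i j. a $ i * b $ j)"
proof -
  have ex: "\<exists>a b :: complex^2. Z = (\<chi> i j. a $ i * b $ j)"
  proof (cases "Z $ 1 = 0")
    case True
    then show ?thesis
      by (intro exI[of _ "\<chi> i. if i = 1 then 0 else 1"] exI[of _ "Z $ 2"]) (simp add: vec_eq_iff forall_2)
  next
    case False
    have d: "Z$1$1 * Z$2$2 = Z$1$2 * Z$2$1" using assms(1) by (simp add: det_2)
    obtain c where "Z$2$1 = c * Z$1$1" "Z$2$2 = c * Z$1$2"
    proof (cases "Z$1$1 = 0")
      case True
      with False have "Z$1$2 \<noteq> 0" by (auto simp: vec_eq_iff forall_2)
      with True d show thesis by (intro that[of "Z$2$2 / Z$1$2"]) auto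
    next
      case False
      with d show thesis by (intro that[of "Z$2$1 / Z$1$1"]) (auto simp: field_simps)
    qed
    then show ?thesis
      by (intro exI[of _ "\<chi> i. if i = 1 then 1 else c"] exI[of _ "Z $ 1"]) (simp add: vec_eq_iff forall_2)
  qed
  then obtain a b :: "complex^2" where Z: "Z = (\<chi> i j. a $ i * b $ j)" by blast
  have "(norm Z)\<^sup>2 = (norm a)\<^sup>2 * (norm b)\<^sup>2"
    by (simp add: Z norm_vec_def L2_set_def sum_2 norm_mult power_mult_distrib algebra_simps)
  then have n: "norm a * norm b = 1"
    using assms(2) by (metis norm_ge_zero mult_nonneg_nonneg power2_eq_imp_eq power_mult_distrib)
  then have na: "norm a > 0" by (metis mult_zero_left norm_eq_zero zero_less_norm_iff zero_neq_one)
  show thesis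
  proof (rule that)
    show "norm ((1 / norm a) *\<^sub>R a) = 1" "norm (norm a *\<^sub>R b) = 1" using na n by simp_all
    show "Z = (\<chi> i j. ((1 / norm a) *\<^sub>R a) $ i * (norm a *\<^sub>R b) $ j)" using na by (simp add: Z)
  qed
qed

lemma pure_product_subset:
  "pure_product \<subseteq> {\<sigma> \<otimes>\<^sub>o \<tau> | (\<sigma> :: qubit_op) (\<tau> :: qubit_op). state \<sigma> \<and> state \<tau>}"
proof
  fix M assume "M \<in> pure_product"
  then obtain Z where M: "M = projector (vec_of Z)" and "det Z = 0" "norm Z = 1"
    by (auto simp: pure_product_def)
  then obtain a b :: "complex^2" where ab: "norm a = 1" "norm b = 1" "Z = (\<chi> i j. a $ i * b $ j)"
    using det_zero_product by blast
  have "M = projector a \<otimes>\<^sub>o projector b"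
    by (simp add: M ab(3) projector_def vec_of_def tensor_op_def vec_eq_iff)
  then show "M \<in> {\<sigma> \<otimes>\<^sub>o \<tau> | (\<sigma> :: qubit_op) (\<tau> :: qubit_op). state \<sigma> \<and> state \<tau>}"
    using state_projector ab(1,2) by blast
qed

lemma separable_if_hull: "M \<in> convex hull pure_product \<Longrightarrow> separable M"
  unfolding separable_def using hull_mono[OF pure_product_subset] by blast

lemma compact_pure_product: "compact pure_product"
  unfolding pure_product_def
proof (rule compact_continuous_image)
  show "continuous_on {Z. det Z = 0 \<and> norm Z = 1} (\<lambda>Z::qubit_op. projector (vec_of Z))"
    unfolding projector_def vec_of_def by (auto intro!: continuous_intros)
  have "closed {Z :: qubit_op. det Z = 0}"
    unfolding det_2 by (intro closed_Collect_eq continuous_intros)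
  moreover have "{Z :: qubit_op. det Z = 0 \<and> norm Z = 1} = sphere 0 1 \<inter> {Z. det Z = 0}" by auto
  ultimately show "compact {Z :: qubit_op. det Z = 0 \<and> norm Z = 1}"
    by (simp add: compact_Int_closed)
qed

lemma closed_hull_pure_product: "closed (convex hull pure_product)"
  by (intro compact_imp_closed compact_convex_hull compact_pure_product)

lemma pure_product_nonempty: "pure_product \<noteq> {}"
proof -
  have "det ((\<chi> i j. if i = 1 \<and> j = 1 then 1 else 0) :: qubit_op) = 0"
    "norm ((\<chi> i j. if i = 1 \<and> j = 1 then 1 else 0) :: qubit_op) = 1"
    by (simp_all add: det_2 norm_vec_def L2_set_def sum_2)
  then show ?thesis unfolding pure_product_def by (metis (mono_tags, lifting) empty_iff imageI mem_Collect_eq)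
qed

text \<open>The cone over the separable states, which spares renormalisation after each
  filter.\<close>

definition product_cone :: "two_qubit_op set" where
  "product_cone = {r *\<^sub>R M | r M. 0 \<le> r \<and> M \<in> convex hull pure_product}"

lemma product_cone_scale: "M \<in> product_cone \<Longrightarrow> 0 \<le> r \<Longrightarrow> r *\<^sub>R M \<in> product_cone"
  by (auto simp: product_cone_def) (metis mult_nonneg_nonneg)

lemma product_cone_add:
  assumes "M \<in> product_cone" "N \<in> product_cone" shows "M + N \<in> product_cone"
proof -
  obtain r s P Q where rs: "0 \<le> r" "0 \<le> s" "M = r *\<^sub>R P" "N = s *\<^sub>R Q"
    and PQ: "P \<in> convex hull pure_product" "Q \<in> convex hull pure_product"
    using assms by (auto simp: product_cone_def)
  show ?thesis
  proof (cases "r + s = 0")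
    case True
    then have "r = 0" "s = 0" using rs by auto
    then show ?thesis using rs PQ by (auto simp: product_cone_def)
  next
    case False
    then have "(r / (r + s)) *\<^sub>R P + (s / (r + s)) *\<^sub>R Q \<in> convex hull pure_product"
      using rs by (intro convexD[OF convex_convex_hull] PQ) (auto simp: add_divide_distrib[symmetric])
    moreover have "M + N = (r + s) *\<^sub>R ((r / (r + s)) *\<^sub>R P + (s / (r + s)) *\<^sub>R Q)"
      using False by (simp add: rs scaleR_add_right)
    moreover have "0 \<le> r + s" using rs by simp
    ultimately show ?thesis unfolding product_cone_def by blast
  qed
qed

lemma product_cone_0: "0 \<in> product_cone"
proof -
  obtain M where "M \<in> convex hull pure_product" using pure_product_nonempty by force
  then show ?thesis unfolding product_cone_def by (auto intro: exI[of _ "0::real"])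
qed

lemma projector_in_product_cone:
  assumes "det Z = 0" shows "projector (vec_of Z) \<in> product_cone"
proof (cases "Z = 0")
  case True
  then have "projector (vec_of Z) = 0" by (simp add: projector_def vec_of_def vec_eq_iff)
  then show ?thesis using product_cone_0 by simp
next
  case False
  define Y where "Y = (1 / norm Z) *\<^sub>R Z"
  have "norm Y = 1" using False by (simp add: Y_def)
  moreover have "det Y = 0" using assms by (simp add: Y_def det_2 flip: right_diff_distrib scaleR_diff_right)
  ultimately have "projector (vec_of Y) \<in> convex hull pure_product"
    by (intro hull_inc) (auto simp: pure_product_def)
  moreover have "projector (vec_of Z) = (norm Z)\<^sup>2 *\<^sub>R projector (vec_of Y)"
    using False by (simp add: Y_def projector_def vec_of_def vec_eq_iff power2_eq_square)
  ultimately show ?thesis unfolding product_cone_def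
    using zero_le_power2[of "norm Z"] by blast
qed

text \<open>If \<open>Z\<close> is singular, so is \<open>A ** Z ** transpose B\<close>; filters
  therefore map product vectors to product vectors, and linearity extends this to the cone.\<close>

lemma product_cone_conjugate:
  assumes "M \<in> product_cone"
  shows "(A \<otimes>\<^sub>o B) ** M ** dagger (A \<otimes>\<^sub>o B) \<in> product_cone"
proof -
  let ?f = "\<lambda>M. (A \<otimes>\<^sub>o B) ** M ** dagger (A \<otimes>\<^sub>o B)"
  have fa: "?f (M + N) = ?f M + ?f N" and fs: "?f (r *\<^sub>R M) = r *\<^sub>R ?f M" for M N r
    unfolding form_eq_iff by (simp_all add: form_conjugate form_add form_scaleR)
  have "convex {M. ?f M \<in> product_cone}"
    unfolding convex_def by (simp add: fa fs product_cone_add product_cone_scale)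
  moreover have "?f (projector (vec_of Z)) = projector (vec_of (A ** Z ** transpose B))" for Z
    unfolding form_eq_iff form_conjugate form_projector by (metis hs_pull hs_cnj)
  then have "pure_product \<subseteq> {M. ?f M \<in> product_cone}"
    by (auto simp: pure_product_def det_mul intro!: projector_in_product_cone)
  ultimately have "convex hull pure_product \<subseteq> {M. ?f M \<in> product_cone}" by (rule hull_minimal[rotated])
  moreover obtain r N where "M = r *\<^sub>R N" "0 \<le> r" "N \<in> convex hull pure_product"
    using assms by (auto simp: product_cone_def)
  ultimately show ?thesis by (auto simp: fs intro: product_cone_scale)
qed

text \<open>All pure products have trace one, so the scaling factor of a cone element is its
  trace.\<close>

lemma product_cone_trace_1:
  assumes "M \<in> product_cone" "trace M = 1" shows "M \<in> convex hull pure_product"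
proof -
  obtain r N where r: "0 \<le> r" "M = r *\<^sub>R N" and N: "N \<in> convex hull pure_product"
    using assms by (auto simp: product_cone_def)
  have ts: "trace (r *\<^sub>R N) = of_real r * trace N" for r and N :: two_qubit_op
    by (simp add: trace_form form_scaleR sum_distrib_left)
  have ta: "trace (N + N') = trace N + trace N'" for N N' :: two_qubit_op
    by (simp add: trace_def sum.distrib)
  have "convex {N :: two_qubit_op. trace N = 1}"
    unfolding convex_def by (simp add: ts ta flip: of_real_add)
  moreover have "pure_product \<subseteq> {N. trace N = 1}"
    by (auto simp: pure_product_def trace_projector norm_vec_of)
  ultimately have "trace N = 1" using hull_minimal[of pure_product "{N. trace N = 1}"] N by blast
  then show ?thesis using assms(2) N r by (simp add: ts)
qed

text \<open>The determinant is the sum of the squares of the quaternion coordinates, so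
  \<open>quat i \<plusminus> \<i> quat j\<close> are product vectors.\<close>

lemma projector_quat_pair:
  assumes "i < 4" "j < 4" "i \<noteq> j"
  shows "projector (vec_of (quat i)) + projector (vec_of (quat j)) \<in> product_cone"
proof -
  let ?Z = "\<lambda>c. quat i + mat c ** quat j"
  have "i \<in> {0,1,2,3}" "j \<in> {0,1,2,3}" using assms by auto
  then have d: "det (?Z c) = 1 + c\<^sup>2" for c
    using assms(3) by (auto simp: mat2_simps power2_eq_square algebra_simps)
  have "projector (vec_of (quat i)) + projector (vec_of (quat j))
    = (1 / 2) *\<^sub>R (projector (vec_of (?Z \<i>)) + projector (vec_of (?Z (-\<i>))))"
  proof -
    have "hs (X + Y) W = hs X W + hs Y W" "hs W (X + Y) = hs W X + hs W Y" for X Y W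
      by (simp_all add: mat2_simps algebra_simps)
    then show ?thesis
      unfolding form_eq_iff form_add form_scaleR form_projector hs_scale_left hs_scale_right
      by (simp add: algebra_simps hs_scale_left hs_scale_right del: quat_entries)
  qed
  also have "\<dots> \<in> product_cone"
    by (intro product_cone_scale product_cone_add projector_in_product_cone) (simp_all add: d)
  finally show ?thesis .
qed

text \<open>Splits four weights into equal pairs: the largest weight \<open>a\<close> shares
  \<open>x\<close> with \<open>b\<close>, \<open>y\<close> with \<open>c\<close> and all of the
  smallest weight \<open>d\<close> with \<open>d\<close>, while \<open>b\<close> and
  \<open>c\<close> share \<open>z\<close>. Nonnegativity of \<open>z\<close> is the last
  hypothesis.\<close>

lemma pair_weights_sorted:
  fixes a b c d :: real
  assumes "0 \<le> d" "d \<le> b" "d \<le> c" "b \<le> a" "c \<le> a" "a \<le> b + c + d"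
  shows "\<exists>x y z. 0 \<le> x \<and> 0 \<le> y \<and> 0 \<le> z \<and> a = x + y + d \<and> b = x + z \<and> c = y + z"
proof (intro exI conjI)
  show "0 \<le> (a - d + b - c) / 2" "0 \<le> (a - d + c - b) / 2" "0 \<le> (b + c + d - a) / 2" using assms by auto
qed (auto simp: field_simps)

lemma ex_extremal_order:
  fixes w :: "nat \<Rightarrow> real"
  obtains k i j l where "{..<4} = {k, i, j, l}" "distinct [k, i, j, l]"
    "w i \<le> w k" "w j \<le> w k" "w l \<le> w i" "w l \<le> w j"
proof -
  have least: "\<exists>k\<in>S. \<forall>i\<in>S. f k \<le> f i" if "finite S" "S \<noteq> {}" for S and f :: "nat \<Rightarrow> real"
    using arg_min_if_finite[OF that, of f] by (auto simp: not_less)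
  obtain k where k: "k < 4" "\<And>i. i < 4 \<Longrightarrow> w i \<le> w k"
    using least[of "{..<4}" "\<lambda>i. - w i"] by (auto simp: lessThan_empty_iff)
  have "card ({..<4} - {k}) = 3" using k(1) by simp
  then have "{..<4} - {k} \<noteq> {}" by (metis card.empty zero_neq_numeral)
  then obtain l where l: "l < 4" "l \<noteq> k" "\<And>i. i < 4 \<Longrightarrow> i \<noteq> k \<Longrightarrow> w l \<le> w i"
    using least[of "{..<4} - {k}" w] by auto
  have "card ({..<4} - {k, l}) = 2" using k(1) l(1,2) by (simp add: card_Diff_subset)
  then obtain i j where ij: "{..<4} - {k, l} = {i, j}" "i \<noteq> j" by (auto simp: card_2_iff)
  show thesis
  proof (rule that)
    show "{..<4} = {k, i, j, l}" using ij k(1) l(1) by blast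
    have "i \<in> {..<4} - {k, l}" "j \<in> {..<4} - {k, l}" using ij(1) by auto
    then show "distinct [k, i, j, l]" "w i \<le> w k" "w j \<le> w k" "w l \<le> w i" "w l \<le> w j"
      using k l ij(2) by auto
  qed
qed

text \<open>Equal mixtures of two Bell projections are separable, and by
  \<open>pair_weights_sorted\<close> a weight vector with no entry above half the total is a sum of
  such pairs.\<close>

lemma quat_diagonal_in_product_cone:
  assumes "quat_diagonal M" and w: "\<And>i. i < 4 \<Longrightarrow> 0 \<le> weight M i"
    "\<And>i. i < 4 \<Longrightarrow> 2 * weight M i \<le> (\<Sum>i<4. weight M i)"
  shows "M \<in> product_cone"
proof -
  let ?e = "\<lambda>i. projector (vec_of (quat i))"
  obtain k i j l where s: "{..<4} = {k, i, j, l}" "distinct [k, i, j, l]" and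
    o: "weight M i \<le> weight M k" "weight M j \<le> weight M k" "weight M l \<le> weight M i" "weight M l \<le> weight M j"
    by (rule ex_extremal_order)
  have lt: "k < 4" "i < 4" "j < 4" "l < 4" using s(1) by blast+
  have sum: "(\<Sum>i<4. f i) = f k + f i + f j + f l" for f :: "nat \<Rightarrow> 'a::comm_monoid_add"
    using s by (simp add: add_ac)
  have "weight M k \<le> weight M i + weight M j + weight M l"
    using w(2)[OF lt(1)] unfolding sum by simp
  then obtain x y z where xyz: "0 \<le> x" "0 \<le> y" "0 \<le> z" "weight M k = x + y + weight M l"
    "weight M i = x + z" "weight M j = y + z"
    using pair_weights_sorted[of "weight M l" "weight M i" "weight M j" "weight M k"] w(1)[OF lt(4)] o by blast
  \<comment> \<open>The prefactor compensates for the squared norm 2 of the unnormalised Bell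
    vectors.\<close>
  have "M = (1 / 2) *\<^sub>R (x *\<^sub>R (?e k + ?e i) + y *\<^sub>R (?e k + ?e j) + weight M l *\<^sub>R (?e k + ?e l) + z *\<^sub>R (?e i + ?e j))"
    unfolding form_eq_iff form_quat_diagonal[OF assms(1)] sum form_add form_scaleR form_projector
    by (simp add: xyz hs_cnj[of _ "quat _"] algebra_simps add_divide_distrib del: quat_entries)
  also have "\<dots> \<in> product_cone"
    using s(2) xyz w(1)[OF lt(4)]
    by (intro product_cone_scale product_cone_add projector_quat_pair lt) auto
  finally show ?thesis .
qed

section \<open>Minimisation over local filters\<close>

lemma psd_conjugate:
  fixes A B :: qubit_op
  assumes "pos_semidef M" shows "pos_semidef ((A \<otimes>\<^sub>o B) ** M ** dagger (A \<otimes>\<^sub>o B))"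
  using assms unfolding psd_iff_form form_conjugate by (simp add: dagger_mult matrix_mul_assoc)

lemma success_prob_nonneg: "pos_semidef M \<Longrightarrow> 0 \<le> success_prob A B M"
  unfolding success_prob_form by (simp add: psd_form_nonneg sum_nonneg)

lemma trace_unitary:
  fixes U V :: qubit_op
  assumes "unitary U" "unitary V"
  shows "trace ((U \<otimes>\<^sub>o V) ** M ** dagger (U \<otimes>\<^sub>o V)) = trace M"
proof -
  have "(mat 1 :: qubit_op) \<otimes>\<^sub>o (mat 1 :: qubit_op) = mat 1" by (simp add: mat2_simps)
  then have "dagger (U \<otimes>\<^sub>o V) ** (U \<otimes>\<^sub>o V) = mat 1"
    using assms by (simp add: dagger_tensor tensor_mult unitary_def)
  then show ?thesis by (metis matrix_mul_assoc matrix_mul_lid trace_mul_sym)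
qed

text \<open>A local unitary takes the first Bell vector to that of \<open>W\<close>; its diagonal
  entry is one of four nonnegative ones adding up to the trace.\<close>

lemma form_le_trace:
  assumes "pos_semidef M" "unitary W"
  shows "Re (form M W W) \<le> 2 * Re (trace M)"
proof -
  let ?f = "\<lambda>i. Re (form M (pull (dagger W) (mat 1) (quat i)) (pull (dagger W) (mat 1) (quat i)))"
  have "pull (dagger W) (mat 1) (quat 0) = W" by (simp add: pull_def) (simp add: mat2_simps)
  then have "Re (form M W W) = ?f 0" by (simp del: quat_entries)
  also have "\<dots> \<le> (\<Sum>i<4. ?f i)" using psd_form_nonneg[OF assms(1)] by (intro member_le_sum) auto
  also have "\<dots> = 2 * success_prob (dagger W) (mat 1) M" unfolding success_prob_form by simp
  also have "\<dots> = 2 * Re (trace M)"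
    unfolding success_prob_def by (simp add: trace_unitary unitary_dagger assms(2))
  finally show ?thesis .
qed

lemma form_pull_le_success_prob:
  assumes "pos_semidef M" "unitary W"
  shows "Re (form M (pull A B W) (pull A B W)) \<le> 2 * success_prob A B M"
  using form_le_trace[OF psd_conjugate[OF assms(1)] assms(2), of A B]
  unfolding form_conjugate success_prob_def .

lemma continuous_on_pull: "continuous_on UNIV (\<lambda>p. pull (fst p) (snd p) X)"
  unfolding pull_def matrix_matrix_mult_def dagger_def transpose_def map_matrix_def conj_op_def
  by (auto intro!: continuous_intros)

lemma continuous_on_cost: "continuous_on UNIV (\<lambda>p. cost d M (fst p) (snd p))"
proof -
  have "continuous_on UNIV (\<lambda>p. Re (form M (pull (fst p) (snd p) X) (pull (fst p) (snd p) X)))" for X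
    using continuous_on_compose[OF continuous_on_pull continuous_on_subset[OF continuous_on_form subset_UNIV], of M X]
    by (simp add: o_def continuous_on_Re)
  then show ?thesis unfolding cost_def by (intro continuous_on_sum continuous_on_mult continuous_on_const)
qed

lemma pull_scale_filters: "pull (mat a ** A) (mat b ** B) X = mat (cnj (a * b)) ** pull A B X"
  by (simp add: pull_def mat2_simps algebra_simps)

lemma form_scale: "form M (mat c ** X) (mat c ** Y) = of_real ((cmod c)\<^sup>2) * form M X Y"
  unfolding form_scale_left form_scale_right complex_norm_square by simp

lemma cost_scale: "cost d M (mat a ** A) (mat b ** B) = (cmod (a * b))\<^sup>2 * cost d M A B"
  unfolding cost_def pull_scale_filters form_scale
  by (simp add: sum_distrib_left mult_ac norm_mult)

lemma cost_conjugate: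
  "cost d ((A \<otimes>\<^sub>o B) ** M ** dagger (A \<otimes>\<^sub>o B)) A' B' = cost d M (A' ** A) (B' ** B)"
  unfolding cost_def form_conjugate pull_mult ..

lemma cost_pos:
  assumes "\<And>X. X \<noteq> 0 \<Longrightarrow> 0 < Re (form M X X)" "\<And>i. 0 < d i" "A \<noteq> 0" "B \<noteq> 0"
  shows "0 < cost d M A B"
proof -
  obtain i where i: "i < 4" "pull A B (quat i) \<noteq> 0" using pull_quat_eq_0 assms(3,4) by blast
  have nn: "0 \<le> d j * Re (form M (pull A B (quat j)) (pull A B (quat j)))" for j
  proof (cases "pull A B (quat j) = 0")
    case True
    then show ?thesis by (simp add: form_entries)
  next
    case False
    then show ?thesis using assms(1,2) by (simp add: less_imp_le)
  qed
  have "0 < d i * Re (form M (pull A B (quat i)) (pull A B (quat i)))" using i assms(1,2) by simp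
  also have "\<dots> \<le> cost d M A B" unfolding cost_def using i(1) nn by (intro member_le_sum) auto
  finally show ?thesis .
qed

lemma norm_mat_mult: "norm (mat c ** X) = cmod c * norm X" for X :: qubit_op
proof -
  have "(norm (mat c ** X))\<^sup>2 = (cmod c * norm X)\<^sup>2"
    by (simp add: norm_vec_def L2_set_def sum_2 mat2_simps norm_mult power_mult_distrib algebra_simps)
  then show ?thesis by simp
qed

text \<open>Scale invariance of the quotient reduces the minimisation to a compact set.\<close>

lemma cost_minimiser:
  assumes pos: "\<And>X. X \<noteq> 0 \<Longrightarrow> 0 < Re (form M X X)" and d: "\<And>i. 0 < d i"
  obtains A0 B0 where "det A0 \<noteq> 0" "det B0 \<noteq> 0"
    "\<And>A B. cmod (det A) * cmod (det B) * cost d M A0 B0 \<le> cmod (det A0) * cmod (det B0) * cost d M A B"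
proof -
  let ?S = "sphere 0 1 \<times> sphere 0 1 :: (qubit_op \<times> qubit_op) set"
  \<comment> \<open>The inverse quotient is maximised: determinants may vanish on the spheres,
    whereas the cost stays positive.\<close>
  let ?h = "\<lambda>p :: qubit_op \<times> qubit_op. cmod (det (fst p)) * cmod (det (snd p)) / cost d M (fst p) (snd p)"
  have "compact ?S" by (intro compact_Times compact_sphere)
  moreover have nz: "0 < cost d M (fst p) (snd p)" if "p \<in> ?S" for p
    using that by (intro cost_pos pos d) auto
  have "continuous_on ?S (\<lambda>p. cost d M (fst p) (snd p))"
    by (rule continuous_on_subset[OF continuous_on_cost]) simp
  then have "continuous_on ?S ?h"
    using nz unfolding det_2 by (intro continuous_intros) (auto simp: less_imp_neq[symmetric])
  moreover
  \<comment> \<open>The normalised identity is a competitor with positive value, so neither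
    determinant vanishes at the maximiser.\<close>
  define I where "I = mat (of_real (1 / norm (mat 1 :: qubit_op))) ** (mat 1 :: qubit_op)"
  have n1: "norm (mat 1 :: qubit_op) > 0" using unitary_norm[OF unitary_one] by (auto simp: zero_less_norm_iff)
  have I: "norm I = 1" "det I \<noteq> 0"
  proof -
    show "norm I = 1" unfolding I_def norm_mat_mult using n1 by (simp add: norm_divide)
    have "norm (mat 1 :: qubit_op) \<noteq> 0" using n1 by simp
    moreover have "det (mat c ** (mat 1 :: qubit_op)) = c * c" for c :: complex
      by (simp add: det_2 mat_def matrix_matrix_mult_def sum_2)
    ultimately show "det I \<noteq> 0" unfolding I_def by simp
  qed
  then have "(I, I) \<in> ?S" by simp
  ultimately obtain p where p: "p \<in> ?S" "\<And>q. q \<in> ?S \<Longrightarrow> ?h q \<le> ?h p"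
    using continuous_attains_sup[of ?S ?h] by blast
  obtain A0 B0 where p0: "p = (A0, B0)" by (cases p)
  have "0 < ?h (I, I)" using I nz[OF \<open>(I, I) \<in> ?S\<close>] by simp
  also have "\<dots> \<le> ?h p" by (rule p) fact
  finally have "det A0 \<noteq> 0" "det B0 \<noteq> 0" by (auto simp: p0)
  moreover have "cmod (det A) * cmod (det B) * cost d M A0 B0 \<le> cmod (det A0) * cmod (det B0) * cost d M A B" for A B
  proof (cases "A = 0 \<or> B = 0")
    case True
    then have "det A = 0 \<or> det B = 0" by (auto simp: det_2)
    moreover have "cost d M A B = 0" using True by (auto simp: cost_def pull_def mat2_simps form_entries)
    ultimately show ?thesis by auto
  next
    case False
    define a b where "a = (of_real (1 / norm A) :: complex)" "b = (of_real (1 / norm B) :: complex)"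
    have ab: "cmod a = 1 / norm A" "cmod b = 1 / norm B" by (simp_all add: a_b_def norm_divide)
    let ?q = "(mat a ** A, mat b ** B)"
    have q: "?q \<in> ?S" using False by (simp add: norm_mat_mult ab)
    have dm: "cmod (det (mat c ** X)) = (cmod c)\<^sup>2 * cmod (det X)" for c and X :: qubit_op
    proof -
      have "det (mat c :: qubit_op) = c * c" by (simp add: det_2 mat_def)
      then show ?thesis by (simp add: det_mul norm_mult power2_eq_square)
    qed
    have "?h ?q = cmod (det A) * cmod (det B) / cost d M A B"
      using False by (simp add: dm cost_scale norm_mult power_mult_distrib ab power_divide)
    then have "cmod (det A) * cmod (det B) / cost d M A B \<le> cmod (det A0) * cmod (det B0) / cost d M A0 B0"
      using p(2)[OF q] by (simp add: p0)
    moreover have "0 < cost d M A B" "0 < cost d M A0 B0"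
      using False nz[OF p(1)] by (auto simp: p0 intro!: cost_pos pos d)
    ultimately show ?thesis by (simp add: field_simps)
  qed
  ultimately show thesis using that by blast
qed

section \<open>Infinitesimal filters and critical points\<close>

lemma pull_left_gen: "pull (mat 1 + mat (of_real t) ** dagger a) (mat 1) X = X + mat (of_real t) ** (a ** X)"
proof -
  have "dagger (mat 1 + mat (of_real t) ** dagger a) = mat 1 + mat (of_real t) ** a"
    by (simp add: mat2_simps)
  moreover have "conj_op (mat 1) = mat 1" by (simp add: mat2_simps)
  ultimately show ?thesis by (simp add: pull_def matrix_add_rdist matrix_mul_assoc)
qed

lemma pull_right_gen: "pull (mat 1) (mat 1 + mat (of_real t) ** conj_op b) X = X + mat (of_real t) ** (X ** b)"
proof -
  have "conj_op (mat 1 + mat (of_real t) ** conj_op b) = mat 1 + mat (of_real t) ** b"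
    by (simp add: mat2_simps)
  then show ?thesis by (simp add: pull_def matrix_add_ldistrib scale_right)
qed

text \<open>The generators are traceless with determinant plus or minus one, so the determinants
  equal \<open>1 + t\<^sup>2\<close> or \<open>1 - t\<^sup>2\<close> and change only to second
  order.\<close>

lemma det_gens:
  assumes "k \<in> {1, 2, 3}" "c = 1 \<or> c = \<i>"
  shows "1 - t\<^sup>2 \<le> cmod (det (mat 1 + mat (of_real t) ** dagger (mat c ** quat k)))"
    and "1 - t\<^sup>2 \<le> cmod (det (mat 1 + mat (of_real t) ** conj_op (mat c ** quat k)))"
proof -
  have "1 - t\<^sup>2 \<le> cmod (1 + of_real t * of_real t)" "1 - t\<^sup>2 \<le> cmod (1 - of_real t * of_real t)"
    using complex_Re_le_cmod[of "1 + of_real t * of_real t"] complex_Re_le_cmod[of "1 - of_real t * of_real t"]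
    by (simp_all add: power2_eq_square) (smt (verit) zero_le_square)
  then show "1 - t\<^sup>2 \<le> cmod (det (mat 1 + mat (of_real t) ** dagger (mat c ** quat k)))"
    "1 - t\<^sup>2 \<le> cmod (det (mat 1 + mat (of_real t) ** conj_op (mat c ** quat k)))"
    using assms by (auto simp: mat2_simps algebra_simps)
qed

lemma form_i: "Re (form M X (mat \<i> ** Y)) = - Im (form M X Y)"
  by (simp add: form_scale_right)

text \<open>Multiplying \<open>quat k\<close> by the imaginary unit gives Hermitian generators, that
  is, genuine filters; they control the imaginary parts.\<close>

lemma stationary_Im_eq_0:
  assumes h: "dagger M = M"
    and l: "\<And>k t. k \<in> {1, 2, 3} \<Longrightarrow> cost d M (mat 1) (mat 1)
      \<le> cost d M (mat 1 + mat (of_real t) ** dagger (mat \<i> ** quat k)) (mat 1) + K * t\<^sup>2"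
    and r: "\<And>k t. k \<in> {1, 2, 3} \<Longrightarrow> cost d M (mat 1) (mat 1)
      \<le> cost d M (mat 1) (mat 1 + mat (of_real t) ** conj_op (mat \<i> ** quat k)) + K * t\<^sup>2"
    and ij: "i < 4" "j < 4" "i \<noteq> j" "d i + d j \<noteq> 0"
  shows "Im (form M (quat i) (quat j)) = 0"
proof -
  have sl: "(\<Sum>i<4. d i * Im (form M (quat i) (quat k ** quat i))) = 0" if "k \<in> {1, 2, 3}" for k
    using stationary[OF h pull_left_gen l[OF that]]
    unfolding matrix_mul_assoc[symmetric] form_i by (simp add: sum_negf)
  have sr: "(\<Sum>i<4. d i * Im (form M (quat i) (quat i ** quat k))) = 0" if "k \<in> {1, 2, 3}" for k
    using stationary[OF h pull_right_gen r[OF that]]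
    unfolding scale_right form_i by (simp add: sum_negf)
  have "(d i + d j) * Im (form M (quat i) (quat j)) = 0"
    by (rule stationary_quat_Im[OF h sl sr ij(1-3)])
  then show ?thesis using ij(4) by simp
qed

text \<open>The anti-Hermitian generators are infinitesimal local unitaries; they control the real
  parts.\<close>

lemma stationary_Re_eq_0:
  assumes h: "dagger M = M"
    and l: "\<And>k t. k \<in> {1, 2, 3} \<Longrightarrow> cost d M (mat 1) (mat 1)
      \<le> cost d M (mat 1 + mat (of_real t) ** dagger (quat k)) (mat 1) + K * t\<^sup>2"
    and r: "\<And>k t. k \<in> {1, 2, 3} \<Longrightarrow> cost d M (mat 1) (mat 1)
      \<le> cost d M (mat 1) (mat 1 + mat (of_real t) ** conj_op (quat k)) + K * t\<^sup>2"
    and ij: "i < 4" "j < 4" "i \<noteq> j" "d i \<noteq> d j"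
  shows "Re (form M (quat i) (quat j)) = 0"
proof -
  have sl: "(\<Sum>i<4. d i * Re (form M (quat i) (quat k ** quat i))) = 0" if "k \<in> {1, 2, 3}" for k
    using stationary[OF h pull_left_gen l[OF that]] .
  have sr: "(\<Sum>i<4. d i * Re (form M (quat i) (quat i ** quat k))) = 0" if "k \<in> {1, 2, 3}" for k
    using stationary[OF h pull_right_gen r[OF that]] .
  have "(d i - d j) * Re (form M (quat i) (quat j)) = 0"
    by (rule stationary_quat_Re[OF h sl sr ij(1-3)])
  then show ?thesis using ij(4) by simp
qed

text \<open>The normalising filters minimise the cost relative to the determinants. At the minimum
  \<open>stationary_Re_eq_0\<close> and \<open>stationary_Im_eq_0\<close> kill all off-diagonal
  entries.\<close>

lemma positive_normal_form:
  assumes h: "dagger M = M" and pos: "\<And>X. X \<noteq> 0 \<Longrightarrow> 0 < Re (form M X X)"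
  obtains A B where "det A \<noteq> 0" "det B \<noteq> 0" "quat_diagonal ((A \<otimes>\<^sub>o B) ** M ** dagger (A \<otimes>\<^sub>o B))"
proof -
  \<comment> \<open>Distinct weights are needed for the real parts, positive ones for the imaginary
    parts and for the positivity of the cost.\<close>
  define d :: "nat \<Rightarrow> real" where "d i = real i + 1" for i
  have d: "0 < d i" for i by (simp add: d_def)
  obtain A0 B0 where dt: "det A0 \<noteq> 0" "det B0 \<noteq> 0" and
    min: "\<And>A B. cmod (det A) * cmod (det B) * cost d M A0 B0 \<le> cmod (det A0) * cmod (det B0) * cost d M A B"
    using cost_minimiser[OF pos, of d] d by blast
  define N where "N = (A0 \<otimes>\<^sub>o B0) ** M ** dagger (A0 \<otimes>\<^sub>o B0)"
  define K where "K = cost d N (mat 1) (mat 1)"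
  have hN: "dagger N = N" by (simp add: N_def dagger_mult h matrix_mul_assoc)
  have K: "K = cost d M A0 B0" by (simp add: K_def N_def cost_conjugate)
  have "A0 \<noteq> 0" "B0 \<noteq> 0" using dt by (auto simp: det_2)
  then have K0: "0 \<le> K" unfolding K using cost_pos[OF pos d] by (simp add: less_imp_le)
  have le: "cmod (det A) * cmod (det B) * K \<le> cost d N A B" for A B
  proof -
    have "cmod (det A0) * cmod (det B0) * (cmod (det A) * cmod (det B) * K)
      \<le> cmod (det A0) * cmod (det B0) * cost d N A B"
      using min[of "A ** A0" "B ** B0"] by (simp add: N_def cost_conjugate K det_mul norm_mult mult_ac)
    then show ?thesis using dt by (simp add: mult_le_cancel_left)
  qed
  \<comment> \<open>A determinant loss of at most \<open>t\<^sup>2\<close> costs at most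
    \<open>K * t\<^sup>2\<close>, the slack allowed by \<open>stationary\<close>.\<close>
  have leA: "K \<le> cost d N A (mat 1) + K * t\<^sup>2" if "1 - t\<^sup>2 \<le> cmod (det A)" for A t
    using le[of A "mat 1"] mult_right_mono[OF that K0] by (simp add: algebra_simps)
  have leB: "K \<le> cost d N (mat 1) A + K * t\<^sup>2" if "1 - t\<^sup>2 \<le> cmod (det A)" for A t
    using le[of "mat 1" A] mult_right_mono[OF that K0] by (simp add: algebra_simps)
  have "form N (quat i) (quat j) = 0" if "i < 4" "j < 4" "i \<noteq> j" for i j
  proof (rule complex_eqI)
    show "Re (form N (quat i) (quat j)) = Re 0"
      using stationary_Re_eq_0[OF hN _ _ that, of d K] leA[OF det_gens(1)[of _ 1]] leB[OF det_gens(2)[of _ 1]] that(3)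
      by (simp add: K_def d_def del: quat_entries)
    show "Im (form N (quat i) (quat j)) = Im 0"
      using stationary_Im_eq_0[OF hN _ _ that, of d K] leA[OF det_gens(1)[of _ "\<i>"]] leB[OF det_gens(2)[of _ "\<i>"]] d[of i] d[of j]
      by (simp add: K_def del: quat_entries)
  qed
  then have "quat_diagonal N" using hN by (simp add: quat_diagonal_def)
  then show thesis using that dt unfolding N_def by blast
qed

section \<open>Separability of states without fidelity gain\<close>

lemma form_mat_1: "form (mat 1) X Y = hs X Y"
  by (simp add: form_def braket_vec_of)

lemma quat_diagonal_mixed: "quat_diagonal ((1 / 4) *\<^sub>R mat 1)" "i < 4 \<Longrightarrow> weight ((1 / 4) *\<^sub>R mat 1) i = 1 / 4"
proof -
  have "dagger ((1 / 4) *\<^sub>R mat 1 :: two_qubit_op) = (1 / 4) *\<^sub>R mat 1"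
    by (simp add: dagger_def transpose_def map_matrix_def vec_eq_iff mat_def)
  then show "quat_diagonal ((1 / 4) *\<^sub>R mat 1)"
    by (simp add: quat_diagonal_def form_scaleR form_mat_1 hs_quat del: quat_entries)
  show "i < 4 \<Longrightarrow> weight ((1 / 4) *\<^sub>R mat 1) i = 1 / 4"
    by (simp add: weight_def form_scaleR form_mat_1 hs_quat del: quat_entries)
qed

text \<open>The maximally mixed state has all weights 1/4, so \<open>filter_overlap_le_half\<close>
  applies; it serves as the noise below.\<close>

lemma mixed_overlap_le:
  assumes "unitary W"
  defines "M \<equiv> (1 / 4) *\<^sub>R mat 1"
  shows "Re (form M (pull A B W) (pull A B W)) \<le> success_prob A B M"
proof -
  have "2 * filter_overlap (weight M) (dagger W ** A) (transpose B) \<le> filter_mass (weight M) (dagger W ** A) (transpose B)"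
    by (rule filter_overlap_le_half) (simp_all add: M_def quat_diagonal_mixed(2))
  also have "\<dots> = success_prob A B M"
    using success_prob_quat_diagonal[OF quat_diagonal_mixed(1)] filter_mass_unitary[OF unitary_dagger[OF assms(1)]]
    by (simp add: M_def)
  finally show ?thesis
    using overlap_quat_diagonal[OF quat_diagonal_mixed(1), of A B W] by (simp add: M_def)
qed

lemma success_prob_one: "success_prob (mat 1) (mat 1) M = Re (trace M)"
  unfolding success_prob_form trace_form by (simp del: quat_entries)

text \<open>For the normal form, the hypothesis at \<open>W = quat i\<close> bounds each weight by
  half the total, which puts it into the product cone. Its filters are invertible, and undoing them
  stays in the cone.\<close>

lemma positive_in_hull:
  assumes h: "dagger M = M" and pos: "\<And>X. X \<noteq> 0 \<Longrightarrow> 0 < Re (form M X X)" and t: "trace M = 1"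
    and le: "\<And>A B W. unitary W \<Longrightarrow> Re (form M (pull A B W) (pull A B W)) \<le> success_prob A B M"
  shows "M \<in> convex hull pure_product"
proof -
  obtain A B where d: "det A \<noteq> 0" "det B \<noteq> 0"
    and q: "quat_diagonal ((A \<otimes>\<^sub>o B) ** M ** dagger (A \<otimes>\<^sub>o B))"
    using positive_normal_form[OF h pos] by blast
  define N where "N = (A \<otimes>\<^sub>o B) ** M ** dagger (A \<otimes>\<^sub>o B)"
  have nn: "0 \<le> Re (form M X X)" for X
  proof (cases "X = 0")
    case True
    then show ?thesis by (simp add: form_entries)
  qed (use pos in \<open>simp add: less_imp_le\<close>)
  have w: "weight N i = Re (form M (pull A B (quat i)) (pull A B (quat i))) / 2" for i
    by (simp add: weight_def N_def form_conjugate)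
  have "(\<Sum>i<4. weight N i) = success_prob A B M"
    by (simp add: w success_prob_form sum_divide_distrib del: quat_entries)
  then have "N \<in> product_cone"
    using q nn le by (intro quat_diagonal_in_product_cone) (simp_all add: N_def[symmetric] w del: quat_entries)
  obtain A' B' where "A' ** A = mat 1" "B' ** B = mat 1"
    using d by (metis invertible_det_nz invertible_left_inverse)
  then have "pull A B (pull A' B' X) = X" for X by (simp add: pull_mult[symmetric])
  then have "M = (A' \<otimes>\<^sub>o B') ** N ** dagger (A' \<otimes>\<^sub>o B')"
    unfolding form_eq_iff form_conjugate N_def by simp
  then have "M \<in> product_cone" using product_cone_conjugate[OF \<open>N \<in> product_cone\<close>] by metis
  then show ?thesis using product_cone_trace_1 t by blast
qed

text \<open>The inequality is linear in the state and holds for the maximally mixed state, so it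
  survives mixing with noise, which makes the form positive definite. The hull of the pure products
  is closed, so the noise can be sent to zero.\<close>

lemma separable_if_no_fidelity_gain:
  assumes "state M"
    and le: "\<And>A B W. unitary W \<Longrightarrow> Re (form M (pull A B W) (pull A B W)) \<le> success_prob A B M"
  shows "separable M"
proof -
  have p: "pos_semidef M" and t: "trace M = 1" and h: "dagger M = M"
    using assms(1) by (simp_all add: state_def pos_semidef_def)
  let ?I = "(1 / 4) *\<^sub>R mat 1 :: two_qubit_op"
  define N where "N e = (1 - e) *\<^sub>R M + e *\<^sub>R ?I" for e :: real
  have fN: "form (N e) X Y = of_real (1 - e) * form M X Y + of_real e * form ?I X Y" for e X Y
    unfolding N_def form_add form_scaleR ..
  have sN: "success_prob A B (N e) = (1 - e) * success_prob A B M + e * success_prob A B ?I" for A B e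
    unfolding success_prob_form fN
    by (simp add: sum.distrib sum_distrib_left[symmetric] add_divide_distrib del: of_real_diff)
  have "N e \<in> convex hull pure_product" if e: "0 < e" "e \<le> 1" for e
  proof (rule positive_in_hull)
    show "dagger (N e) = N e"
      using h quat_diagonal_mixed(1) unfolding N_def quat_diagonal_def
      by (simp add: dagger_def transpose_def map_matrix_def vec_eq_iff)
    show "0 < Re (form (N e) X X)" if "X \<noteq> 0" for X
    proof -
      have "0 \<le> (1 - e) * Re (form M X X)" using e psd_form_nonneg[OF p] by simp
      moreover have "0 < e * Re (form ?I X X)" using e that
        by (simp add: form_scaleR form_mat_1 hs_self flip: of_real_power)
      ultimately show ?thesis by (simp add: fN)
    qed
    have "trace (N e) = of_real (1 - e) * trace M + of_real e * trace ?I"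
      unfolding trace_form fN by (simp add: sum.distrib sum_distrib_left add_divide_distrib)
    moreover have "trace ?I = 1" by (simp add: trace_def mat_def sum_pair2 scaleR_conv_of_real[where 'a=complex])
    ultimately show "trace (N e) = 1" using t by simp
    show "Re (form (N e) (pull A B W) (pull A B W)) \<le> success_prob A B (N e)" if "unitary W" for A B W
      unfolding fN sN using le[OF that, of A B] mixed_overlap_le[OF that, of A B] e
      by (simp add: add_mono mult_left_mono)
  qed
  then have "N (inverse (real (Suc n))) \<in> convex hull pure_product" for n
    by (simp add: inverse_le_1_iff)
  moreover have "(\<lambda>n. N (inverse (real (Suc n)))) \<longlonglongrightarrow> (1 - 0) *\<^sub>R M + 0 *\<^sub>R ?I"
    unfolding N_def by (intro tendsto_intros LIMSEQ_inverse_real_of_nat)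
  ultimately have "M \<in> convex hull pure_product"
    using closed_sequentially[OF closed_hull_pure_product, of "\<lambda>n. N (inverse (real (Suc n)))"] by simp
  then show ?thesis by (rule separable_if_hull)
qed

section \<open>Contractive filters and fidelity above one half\<close>

text \<open>The norm of a matrix is here its Frobenius norm, which by Cauchy-Schwarz dominates the
  operator norm.\<close>

lemma contraction_if_norm_le_1:
  fixes A :: qubit_op
  assumes "norm A \<le> 1" shows "contraction A"
proof -
  have "norm (A *v v) \<le> norm A * norm v" for v
  proof -
    have "cmod ((A *v v) $ i) \<le> norm (A $ i) * norm v" for i
    proof -
      have "cmod ((A *v v) $ i) \<le> (\<Sum>j\<in>UNIV. \<bar>cmod (A $ i $ j)\<bar> * \<bar>cmod (v $ j)\<bar>)"
        unfolding matrix_vector_mult_def by (simp add: norm_mult[symmetric] norm_sum)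
      also have "\<dots> \<le> norm (A $ i) * norm v"
        unfolding norm_vec_def by (rule L2_set_mult_ineq)
      finally show ?thesis .
    qed
    then have "norm (A *v v) \<le> L2_set (\<lambda>i. norm (A $ i) * norm v) UNIV"
      unfolding norm_vec_def[of "A *v v"] by (intro L2_set_mono) auto
    also have "\<dots> = norm A * norm v"
      unfolding norm_vec_def[of A] by (simp add: L2_set_left_distrib)
    finally show ?thesis .
  qed
  then show ?thesis unfolding contraction_def using assms
    by (meson mult_left_le_one_le norm_ge_zero order_trans)
qed

lemma contraction_unitary_mult:
  assumes "contraction A" "unitary U" shows "contraction (U ** A)"
proof -
  have "norm (U *v v) = norm v" for v
  proof -
    have "braket (U *v v) (U *v v) = braket v v"
      unfolding braket_mult using assms(2) by (simp add: unitary_def matrix_vector_mul_assoc)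
    then show ?thesis unfolding braket_self of_real_eq_iff by simp
  qed
  then show ?thesis using assms(1) by (simp add: contraction_def matrix_vector_mul_assoc[symmetric])
qed

text \<open>Rescaling changes the success probability but not the output, so the contraction
  requirement does not restrict the reachable states.\<close>

lemma scaled_filters:
  assumes "0 < success_prob A B M"
  obtains A' B' where "(A', B') \<in> filters M" "filtered A' B' M = filtered A B M"
proof -
  have "pull 0 B X = 0" "pull A 0 X = 0" for X by (simp_all add: pull_def mat2_simps)
  moreover have "form M 0 0 = 0" by (simp add: form_entries)
  ultimately have "A \<noteq> 0" "B \<noteq> 0" using assms by (auto simp: success_prob_form)
  define a b where "a = (of_real (1 / norm A) :: complex)" "b = (of_real (1 / norm B) :: complex)"
  have ab: "cmod a = 1 / norm A" "cmod b = 1 / norm B" by (simp_all add: a_b_def norm_divide)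
  then have nz: "(cmod (cnj (a * b)))\<^sup>2 > 0" using \<open>A \<noteq> 0\<close> \<open>B \<noteq> 0\<close> by auto
  have s: "success_prob (mat a ** A) (mat b ** B) M = (cmod (cnj (a * b)))\<^sup>2 * success_prob A B M"
    unfolding success_prob_form pull_scale_filters form_scale by (simp add: sum_distrib_left)
  have "norm (mat a ** A) \<le> 1" "norm (mat b ** B) \<le> 1"
    using ab \<open>A \<noteq> 0\<close> \<open>B \<noteq> 0\<close> by (simp_all add: norm_mat_mult)
  then have "(mat a ** A, mat b ** B) \<in> filters M"
    using nz assms by (simp add: filters_def contraction_if_norm_le_1 s)
  moreover have "filtered (mat a ** A) (mat b ** B) M = filtered A B M"
    unfolding form_eq_iff form_filtered s pull_scale_filters form_scale using nz by simp
  ultimately show thesis using that by blast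
qed

lemma exists_good_filters:
  assumes "state M" "entangled M"
  obtains A B where "(A, B) \<in> filters M" "fidelity (filtered A B M) > 1 / 2"
proof (rule ccontr)
  assume nt: "\<not> thesis"
  note found = that
  have no: "fidelity (filtered A B M) \<le> 1 / 2" if "(A, B) \<in> filters M" for A B
    using found[OF that] nt by (metis not_le)
  have p: "pos_semidef M" using assms(1) by (simp add: state_def)
  have "Re (form M (pull A B W) (pull A B W)) \<le> success_prob A B M" if "unitary W" for A B W
  \<comment> \<open>A filter that never succeeds has no output to appeal to, but then the overlap is
    at most zero.\<close>
  proof (cases "success_prob A B M = 0")
    case True
    then show ?thesis using form_pull_le_success_prob[OF p that, of A B] by simp
  next
    case False
    then have s: "0 < success_prob A B M" using success_prob_nonneg[OF p, of A B] by simp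
    then obtain A' B' where "(A', B') \<in> filters M" "filtered A' B' M = filtered A B M"
      using scaled_filters by blast
    then have "fidelity (filtered A B M) \<le> 1 / 2" using no by metis
    then have "Re (form (filtered A B M) W W) \<le> 1" using fidelity_ge[OF that, of "filtered A B M"] by simp
    then show ?thesis unfolding form_filtered using s by (simp add: field_simps)
  qed
  then have "separable M" using separable_if_no_fidelity_gain[OF assms(1)] by blast
  then show False using assms(2) by (simp add: entangled_def)
qed

section \<open>Real operators in the quaternion basis\<close>

lemma state_conjugate_unitary:
  fixes U V :: qubit_op
  assumes "state M" "unitary U" "unitary V"
  shows "state ((U \<otimes>\<^sub>o V) ** M ** dagger (U \<otimes>\<^sub>o V))"
  using assms psd_conjugate trace_unitary by (simp add: state_def)

text \<open>Expresses that all quaternion coordinates are real; together with unitarity this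
  describes SU(2).\<close>

definition real_quat :: "qubit_op \<Rightarrow> bool" where
  "real_quat X \<longleftrightarrow> adj2 X = dagger X"

lemma real_quat_quat: "i < 4 \<Longrightarrow> real_quat (quat i)"
proof -
  assume "i < 4"
  then have "i \<in> {0,1,2,3}" by auto
  then show ?thesis by (auto simp: real_quat_def) (simp_all add: mat2_simps)
qed

lemma real_quat_mult: "real_quat X \<Longrightarrow> real_quat Y \<Longrightarrow> real_quat (X ** Y)"
proof -
  have "adj2 (X ** Y) = adj2 Y ** adj2 X" by (simp add: mat2_simps algebra_simps)
  then show "real_quat X \<Longrightarrow> real_quat Y \<Longrightarrow> ?thesis" by (simp add: real_quat_def dagger_mult)
qed

lemma real_quat_dagger: "real_quat X \<Longrightarrow> real_quat (dagger X)"
proof -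
  have "adj2 (dagger X) = dagger (adj2 X)" by (simp add: mat2_simps)
  then show "real_quat X \<Longrightarrow> ?thesis" by (simp add: real_quat_def)
qed

lemma real_quat_conj_op: "real_quat X \<Longrightarrow> real_quat (conj_op X)"
proof -
  have "adj2 (conj_op X) = conj_op (adj2 X)" "dagger (conj_op X) = conj_op (dagger X)" by (simp_all add: mat2_simps)
  then show "real_quat X \<Longrightarrow> ?thesis" by (simp add: real_quat_def)
qed

lemma real_quat_pull: "real_quat U \<Longrightarrow> real_quat V \<Longrightarrow> real_quat X \<Longrightarrow> real_quat (pull U V X)"
  unfolding pull_def by (intro real_quat_mult real_quat_dagger real_quat_conj_op)

lemma real_quat_scale: "real_quat X \<Longrightarrow> real_quat (mat (of_real r) ** X)"
proof -
  have "adj2 (mat (of_real r) ** X) = mat (of_real r) ** adj2 X"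
    "dagger (mat (of_real r) ** X) = mat (of_real r) ** dagger X" by (simp_all add: mat2_simps)
  then show "real_quat X \<Longrightarrow> ?thesis" by (simp add: real_quat_def)
qed

lemma real_quat_add: "real_quat X \<Longrightarrow> real_quat Y \<Longrightarrow> real_quat (X + Y)"
proof -
  have "adj2 (X + Y) = adj2 X + adj2 Y" "dagger (X + Y) = dagger X + dagger Y" by (simp_all add: mat2_simps)
  then show "real_quat X \<Longrightarrow> real_quat Y \<Longrightarrow> ?thesis" by (simp add: real_quat_def)
qed

lemma real_quat_hs:
  assumes "real_quat X" "i < 4" shows "Im (hs (quat i) X) = 0"
proof -
  have i: "i \<in> {0,1,2,3}" using assms(2) by auto
  have "adj2 X $ 1 $ 1 = dagger X $ 1 $ 1" "adj2 X $ 2 $ 1 = dagger X $ 2 $ 1"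
    using assms(1) by (simp_all add: real_quat_def)
  then have "X $ 2 $ 2 = cnj (X $ 1 $ 1)" "- (X $ 2 $ 1) = cnj (X $ 1 $ 2)"
    by (simp_all add: adj2_def dagger_def transpose_def map_matrix_def)
  then have "X $ 2 $ 2 = cnj (X $ 1 $ 1)" "X $ 2 $ 1 = - cnj (X $ 1 $ 2)" by (simp, metis minus_minus)
  with i show ?thesis by (auto simp: hs_def sum_2) (simp_all add: mat_def)
qed

lemma real_quat_form:
  assumes "\<And>i j. i < 4 \<Longrightarrow> j < 4 \<Longrightarrow> Im (form M (quat i) (quat j)) = 0" "real_quat X" "real_quat Y"
  shows "Im (form M X Y) = 0"
  unfolding form_expand[of M X Y] using assms real_quat_hs by (simp add: Im_divide_numeral)

lemma compact_special_unitary: "compact {U. unitary U \<and> real_quat U}"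
proof -
  have "continuous_on UNIV adj2"
    unfolding adj2_def[abs_def]
  proof (intro continuous_on_vec_lambda)
    fix i j :: 2
    show "continuous_on UNIV (\<lambda>X::qubit_op. if i = j then if i = 1 then X $ 2 $ 2 else X $ 1 $ 1 else - X $ i $ j)"
      by (cases "i = j"; cases "i = 1") (auto intro!: continuous_intros)
  qed
  moreover have "continuous_on UNIV (dagger :: qubit_op \<Rightarrow> qubit_op)"
    unfolding dagger_def[abs_def] transpose_def map_matrix_def by (auto intro!: continuous_intros)
  ultimately have "closed {U. real_quat U}"
    unfolding real_quat_def by (intro closed_Collect_eq)
  moreover have "{U. unitary U \<and> real_quat U} = {U. unitary U} \<inter> {U. real_quat U}" by auto
  ultimately show ?thesis by (simp add: compact_unitary compact_Int_closed)
qed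

text \<open>Division by the square root of \<open>1 + t\<^sup>2\<close> therefore brings these
  generators into SU(2).\<close>

lemma gen_mult_dagger:
  assumes "k \<in> {1, 2, 3}" "X = mat 1 + mat (of_real t) ** dagger (quat k) \<or> X = mat 1 + mat (of_real t) ** conj_op (quat k)"
  shows "X ** dagger X = mat (of_real (1 + t\<^sup>2))" "real_quat X"
proof -
  have "k < 4" using assms(1) by auto
  then show "real_quat X" using assms(2) real_quat_quat[of 0]
    by (auto intro!: real_quat_add real_quat_scale real_quat_dagger real_quat_conj_op real_quat_quat)
  show "X ** dagger X = mat (of_real (1 + t\<^sup>2))" using assms
    by (elim insertE emptyE disjE; hypsubst; hypsubst?; simp add: mat2_simps power2_eq_square algebra_simps)
qed

text \<open>In the quaternion basis pairs from SU(2) act as rotations of real four-space, so this is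
  the diagonalisation of a real symmetric matrix. It is carried out by maximising a weighted sum of
  diagonal entries over the compact group; rotations keep the form real.\<close>

lemma real_normal_form:
  assumes "state N" and im: "\<And>i j. i < 4 \<Longrightarrow> j < 4 \<Longrightarrow> i \<noteq> j \<Longrightarrow> Im (form N (quat i) (quat j)) = 0"
  obtains U V where "unitary U" "unitary V" "bell_diagonal ((U \<otimes>\<^sub>o V) ** N ** dagger (U \<otimes>\<^sub>o V))"
proof -
  let ?K = "{U. unitary U \<and> real_quat U}"
  \<comment> \<open>The weights 0, 1, 2, 3 are distinct, as \<open>stationary_Re_eq_0\<close>
    requires.\<close>
  let ?c = "cost real N"
  have hN: "dagger N = N" using assms(1) by (simp add: state_def pos_semidef_def)
  have imN: "Im (form N (quat i) (quat j)) = 0" if "i < 4" "j < 4" for i j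
    using im[OF that] form_self_real[OF hN, of "quat i"] by (cases "i = j") (metis Im_complex_of_real)+
  have "mat 1 \<in> ?K" using real_quat_quat[of 0] by simp
  then have "\<exists>p\<in>?K \<times> ?K. \<forall>q\<in>?K \<times> ?K. ?c (fst q) (snd q) \<le> ?c (fst p) (snd p)"
    by (intro continuous_attains_sup compact_Times compact_special_unitary
        continuous_on_subset[OF continuous_on_cost]) (auto intro: exI[of _ "mat 1"])
  then obtain U V where UV: "U \<in> ?K" "V \<in> ?K" and max: "\<And>A B. A \<in> ?K \<Longrightarrow> B \<in> ?K \<Longrightarrow> ?c A B \<le> ?c U V"
    by fastforce
  define P where "P = (U \<otimes>\<^sub>o V) ** N ** dagger (U \<otimes>\<^sub>o V)"
  have sP: "state P" unfolding P_def using state_conjugate_unitary[OF assms(1)] UV by simp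
  then have hP: "dagger P = P" by (simp add: state_def pos_semidef_def)
  define k where "k = cost real P (mat 1) (mat 1)"
  have maxP: "cost real P A B \<le> k" if "A \<in> ?K" "B \<in> ?K" for A B
  proof -
    have "A ** U \<in> ?K" "B ** V \<in> ?K" using that UV by (auto intro: unitary_mult real_quat_mult)
    then show ?thesis using max by (simp add: P_def k_def cost_conjugate)
  qed
  \<comment> \<open>The stationarity lemmas are stated for minima, so the weights are
    negated.\<close>
  have neg: "cost (\<lambda>i. - real i) P A B = - cost real P A B" for A B
    by (simp add: cost_def sum_negf)
  have scaled: "mat (of_real (1 / sqrt (1 + t\<^sup>2))) ** X \<in> ?K" if "X ** dagger X = mat (of_real (1 + t\<^sup>2))" "real_quat X" for X t
  proof -
    have "0 < 1 + t\<^sup>2" by (simp add: add_pos_nonneg)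
    then show ?thesis using scaled_unitary[OF that(1)] real_quat_scale[OF that(2)] by blast
  qed
  have sq: "(cmod (of_real (1 / sqrt (1 + t\<^sup>2))))\<^sup>2 * z = z / (1 + t\<^sup>2)" for t z :: real
  proof -
    have "0 < 1 + t\<^sup>2" by (simp add: add_pos_nonneg)
    then show ?thesis by (simp add: norm_divide power_divide)
  qed
  have leA: "cost (\<lambda>i. - real i) P (mat 1) (mat 1) \<le> cost (\<lambda>i. - real i) P X (mat 1) + k * t\<^sup>2"
    if X: "X ** dagger X = mat (of_real (1 + t\<^sup>2))" "real_quat X" for X t
  proof -
    have "cost real P X (mat 1) / (1 + t\<^sup>2) \<le> k"
      using maxP[OF scaled[OF X] \<open>mat 1 \<in> ?K\<close>] cost_scale[of real P "of_real (1 / sqrt (1 + t\<^sup>2))" X 1 "mat 1"]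
      by (simp only: sq mult_1_right matrix_mul_lid)
    moreover have "0 < 1 + t\<^sup>2" by (simp add: add_pos_nonneg)
    ultimately show ?thesis unfolding neg k_def[symmetric] by (simp add: field_simps)
  qed
  have leB: "cost (\<lambda>i. - real i) P (mat 1) (mat 1) \<le> cost (\<lambda>i. - real i) P (mat 1) X + k * t\<^sup>2"
    if X: "X ** dagger X = mat (of_real (1 + t\<^sup>2))" "real_quat X" for X t
  proof -
    have "cost real P (mat 1) X / (1 + t\<^sup>2) \<le> k"
      using maxP[OF \<open>mat 1 \<in> ?K\<close> scaled[OF X]] cost_scale[of real P 1 "mat 1" "of_real (1 / sqrt (1 + t\<^sup>2))" X]
      by (simp only: sq mult_1_left matrix_mul_lid)
    moreover have "0 < 1 + t\<^sup>2" by (simp add: add_pos_nonneg)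
    ultimately show ?thesis unfolding neg k_def[symmetric] by (simp add: field_simps)
  qed
  have gen: "cost (\<lambda>i. - real i) P (mat 1) (mat 1)
      \<le> cost (\<lambda>i. - real i) P (mat 1 + mat (of_real t) ** dagger (quat n)) (mat 1) + k * t\<^sup>2"
    "cost (\<lambda>i. - real i) P (mat 1) (mat 1)
      \<le> cost (\<lambda>i. - real i) P (mat 1) (mat 1 + mat (of_real t) ** conj_op (quat n)) + k * t\<^sup>2"
    if n: "n \<in> {1, 2, 3}" for n t
    using leA[OF gen_mult_dagger[OF n]] leB[OF gen_mult_dagger[OF n]] by blast+
  have "form P (quat i) (quat j) = 0" if ij: "i < 4" "j < 4" "i \<noteq> j" for i j
  proof (rule complex_eqI)
    show "Re (form P (quat i) (quat j)) = Re 0"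
      using stationary_Re_eq_0[OF hP gen ij] ij(3) by simp
    show "Im (form P (quat i) (quat j)) = Im 0"
      unfolding P_def form_conjugate using real_quat_form[OF imN] UV real_quat_pull real_quat_quat ij by simp
  qed
  then have "bell_diagonal P" using sP by (simp add: bell_diagonal_iff)
  then show thesis using that UV unfolding P_def by blast
qed

text \<open>Rotating \<open>W\<close> to \<open>mat 1\<close> makes optimality say that a cost with
  weights \<open>F - 1\<close>, \<open>F\<close>, \<open>F\<close>, \<open>F\<close> is nonnegative
  for all filters, and it vanishes without filtering. So the trivial filter is a minimum, with no
  slack required.\<close>

lemma optimal_real:
  assumes "state M" "unitary W" and F: "F = Re (form M W W) / 2" "1 / 2 < F"
    and opt: "\<And>A B. Re (form M (pull A B (mat 1)) (pull A B (mat 1))) \<le> 2 * F * success_prob A B M"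
    and ij: "i < 4" "j < 4" "i \<noteq> j"
  defines "N \<equiv> (dagger W \<otimes>\<^sub>o mat 1) ** M ** dagger (dagger W \<otimes>\<^sub>o mat 1)"
  shows "Im (form N (quat i) (quat j)) = 0"
proof -
  have sN: "state N" unfolding N_def by (intro state_conjugate_unitary assms unitary_dagger unitary_one)
  then have hN: "dagger N = N" by (simp add: state_def pos_semidef_def)
  define d :: "nat \<Rightarrow> real" where "d i = F - (if i = 0 then 1 else 0)" for i
  have c: "cost d N A B = 2 * F * success_prob A B N - Re (form N (pull A B (mat 1)) (pull A B (mat 1)))" for A B
    unfolding cost_def success_prob_form d_def by (simp add: sum_lt4 algebra_simps)
  have pc: "success_prob A B N = success_prob (A ** dagger W) (B ** mat 1) M" for A B
    unfolding success_prob_form N_def form_conjugate pull_mult ..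
  have pos: "0 \<le> cost d N A B" for A B
    using opt[of "A ** dagger W" "B ** mat 1"] unfolding c pc unfolding N_def form_conjugate pull_mult by simp
  have "pull (dagger W) (mat 1) (mat 1) = W" by (simp add: pull_def) (simp add: mat2_simps)
  then have "cost d N (mat 1) (mat 1) = 0"
    unfolding c success_prob_one using sN by (simp add: state_def N_def form_conjugate F)
  then have le: "cost d N (mat 1) (mat 1) \<le> cost d N A B + 0 * t\<^sup>2" for A B t using pos by simp
  \<comment> \<open>The sums are \<open>2 * F - 1\<close> and \<open>2 * F\<close>; a fidelity above
    one half keeps both nonzero.\<close>
  have "d i + d j \<noteq> 0" using F(2) ij(3) by (auto simp: d_def)
  then show ?thesis using stationary_Im_eq_0[OF hN le le ij] by blast
qed

section \<open>The normal form theorem\<close>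

lemma state_filtered:
  assumes "state M" "0 < success_prob A B M"
  shows "state (filtered A B M)"
proof -
  let ?N = "(A \<otimes>\<^sub>o B) ** M ** dagger (A \<otimes>\<^sub>o B)"
  let ?s = "success_prob A B M"
  have p: "pos_semidef ?N" using assms(1) psd_conjugate by (simp add: state_def)
  have ds: "dagger (r *\<^sub>R X) = r *\<^sub>R dagger X" for r and X :: two_qubit_op
    by (simp add: dagger_def transpose_def map_matrix_def vec_eq_iff)
  have ts: "trace (r *\<^sub>R X) = of_real r * trace X" for r and X :: two_qubit_op
    by (simp add: trace_form form_scaleR sum_distrib_left)
  have "dagger ?N = ?N" using p by (simp add: pos_semidef_def)
  then have "trace ?N = of_real ?s"
    unfolding success_prob_def trace_form by (simp add: Re_divide_numeral form_self_real[symmetric] del: quat_entries)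
  then have "trace (filtered A B M) = 1"
    unfolding filtered_def ts using assms(2) by simp
  moreover have "pos_semidef (filtered A B M)"
    using p assms(2) unfolding psd_iff_form by (simp add: filtered_def ds form_scaleR)
  ultimately show ?thesis by (simp add: state_def)
qed

lemma success_prob_unitary_mult:
  assumes "unitary U" "unitary V"
  shows "success_prob (U ** A) (V ** B) M = success_prob A B M"
proof -
  have "(U ** A) \<otimes>\<^sub>o (V ** B) = (U \<otimes>\<^sub>o V) ** (A \<otimes>\<^sub>o B)" by (simp add: tensor_mult)
  then show ?thesis
    using trace_unitary[OF assms, of "(A \<otimes>\<^sub>o B) ** M ** dagger (A \<otimes>\<^sub>o B)"]
    unfolding success_prob_def by (simp add: dagger_mult matrix_mul_assoc)
qed

lemma filtered_unitary_mult:
  assumes "unitary U" "unitary V"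
  shows "filtered (U ** A) (V ** B) M = (U \<otimes>\<^sub>o V) ** filtered A B M ** dagger (U \<otimes>\<^sub>o V)"
  unfolding form_eq_iff form_conjugate form_filtered success_prob_unitary_mult[OF assms] pull_mult by simp

text \<open>An optimal output becomes real in the quaternion basis after one local unitary, and
  Bell-diagonal after another. Appending local unitaries keeps the filters contractive and the
  success probability unchanged.\<close>

lemma normal_form_of_optimal:
  assumes "state \<rho>" "entangled \<rho>" "(A, B) \<in> optimal_filters \<rho>"
  obtains \<beta> where "bell_diagonal_normal_form \<rho> \<beta>"
proof -
  have AB: "contraction A" "contraction B" "0 < success_prob A B \<rho>"
    and max: "\<And>A' B'. (A', B') \<in> filters \<rho> \<Longrightarrow> fidelity (filtered A' B' \<rho>) \<le> fidelity (filtered A B \<rho>)"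
    using assms(3) by (auto simp: optimal_filters_def filters_def)
  define \<omega> where "\<omega> = filtered A B \<rho>"
  have s\<omega>: "state \<omega>" unfolding \<omega>_def by (rule state_filtered[OF assms(1) AB(3)])
  then have p\<omega>: "pos_semidef \<omega>" by (simp add: state_def)
  obtain W where W: "unitary W" "fidelity \<omega> = Re (form \<omega> W W) / 2"
    by (rule fidelity_attained)
  obtain Ag Bg where "(Ag, Bg) \<in> filters \<rho>" "1 / 2 < fidelity (filtered Ag Bg \<rho>)"
    by (rule exists_good_filters[OF assms(1,2)])
  then have half: "1 / 2 < fidelity \<omega>" using max[of Ag Bg] unfolding \<omega>_def by linarith
  \<comment> \<open>A further filter on \<open>\<omega>\<close> composes with \<open>A\<close> and
    \<open>B\<close> to a filter on \<open>\<rho>\<close>, so it cannot raise the fidelity.\<close>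
  have opt: "Re (form \<omega> (pull A' B' (mat 1)) (pull A' B' (mat 1))) \<le> 2 * fidelity \<omega> * success_prob A' B' \<omega>" for A' B'
  proof (cases "success_prob A' B' \<omega> = 0")
    case True
    then show ?thesis using form_pull_le_success_prob[OF p\<omega> unitary_one, of A' B'] by simp
  next
    case False
    then have s: "0 < success_prob A' B' \<omega>" using success_prob_nonneg[OF p\<omega>, of A' B'] by simp
    then have "0 < success_prob (A' ** A) (B' ** B) \<rho>"
      using AB(3) by (simp add: \<omega>_def success_prob_filtered zero_less_divide_iff)
    then obtain A2 B2 where "(A2, B2) \<in> filters \<rho>" "filtered A2 B2 \<rho> = filtered (A' ** A) (B' ** B) \<rho>"
      using scaled_filters by blast
    then have "fidelity (filtered A' B' \<omega>) \<le> fidelity \<omega>"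
      using max[of A2 B2] AB(3) by (simp add: \<omega>_def filtered_filtered)
    then have "Re (form (filtered A' B' \<omega>) (mat 1) (mat 1)) / 2 \<le> fidelity \<omega>"
      using fidelity_ge[OF unitary_one, of "filtered A' B' \<omega>"] by linarith
    then show ?thesis unfolding form_filtered using s by (simp add: field_simps)
  qed
  let ?N = "(dagger W \<otimes>\<^sub>o mat 1) ** \<omega> ** dagger (dagger W \<otimes>\<^sub>o mat 1)"
  have sN: "state ?N" using state_conjugate_unitary[OF s\<omega>] W(1) unitary_dagger unitary_one by blast
  obtain U V where UV: "unitary U" "unitary V" "bell_diagonal ((U \<otimes>\<^sub>o V) ** ?N ** dagger (U \<otimes>\<^sub>o V))"
    using real_normal_form[OF sN] optimal_real[OF s\<omega> W half opt] by blast
  let ?A = "U ** (dagger W ** A)" let ?B = "V ** (mat 1 ** B)"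
  have "filtered ?A ?B \<rho> = (U \<otimes>\<^sub>o V) ** ?N ** dagger (U \<otimes>\<^sub>o V)"
    by (simp only: filtered_unitary_mult[OF UV(1,2)] filtered_unitary_mult[OF unitary_dagger[OF W(1)] unitary_one] \<omega>_def)
  moreover have "success_prob ?A ?B \<rho> = success_prob A B \<rho>"
    by (simp only: success_prob_unitary_mult[OF UV(1,2)] success_prob_unitary_mult[OF unitary_dagger[OF W(1)] unitary_one])
  then have "(?A, ?B) \<in> filters \<rho>"
    unfolding filters_def using AB UV(1,2) unitary_dagger[OF W(1)] by (simp add: contraction_unitary_mult)
  ultimately have "bell_diagonal_normal_form \<rho> ((U \<otimes>\<^sub>o V) ** ?N ** dagger (U \<otimes>\<^sub>o V))"
    unfolding bell_diagonal_normal_form_def using UV(3) by blast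
  then show thesis by (rule that)
qed

text \<open>After a singular filter \<open>A\<close>, the local filter \<open>adj2 A\<close> would
  never succeed, as \<open>adj2 A ** A\<close> is zero. On a Bell-diagonal state a one-sided filter
  fails surely only if it is zero, so \<open>A\<close> would vanish and could not have
  succeeded.\<close>

lemma bell_filters_invertible:
  assumes "bell_diagonal (filtered A B \<rho>)" "0 < success_prob A B \<rho>"
  shows "det A \<noteq> 0" "det B \<noteq> 0"
proof -
  let ?b = "filtered A B \<rho>"
  note b = bell_diagonal_weights[OF assms(1)]
  have z: "success_prob A' B' ?b = 0" if "A' ** A = 0 \<or> B' ** B = 0" for A' B'
  proof -
    have "pull 0 Y X = 0" "pull Y 0 X = 0" for X Y by (simp_all add: pull_def mat2_simps)
    moreover have "form \<rho> 0 0 = 0" by (simp add: form_entries)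
    ultimately have "success_prob (A' ** A) (B' ** B) \<rho> = 0" using that unfolding success_prob_form by auto
    then show ?thesis by (simp add: success_prob_filtered)
  qed
  \<comment> \<open>The reduced states of a Bell-diagonal state are maximally mixed.\<close>
  have m: "filter_mass (weight ?b) X (mat 1) = (norm X)\<^sup>2 / 2" "filter_mass (weight ?b) (mat 1) X = (norm X)\<^sup>2 / 2" for X
  proof -
    have "norm (X ** quat i) = norm X" if "i < 4" for i
    proof -
      have "hs (X ** quat i) (X ** quat i) = hs X X"
      proof -
        have "i \<in> {0,1,2,3}" using that by auto
        then show ?thesis by (auto simp: hs_def matrix_matrix_mult_def sum_2) (simp_all add: mat_def algebra_simps)
      qed
      then show ?thesis by (simp add: hs_self flip: of_real_power)
    qed
    then show "filter_mass (weight ?b) X (mat 1) = (norm X)\<^sup>2 / 2" "filter_mass (weight ?b) (mat 1) X = (norm X)\<^sup>2 / 2"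
      unfolding filter_mass_def using b(2) by (simp_all add: norm_unitary_mult sum_distrib_right[symmetric] del: quat_entries)
  qed
  have adj0: "X = 0" if "adj2 X = 0" for X
    using that by (auto simp: vec_eq_iff forall_2 adj2_def)
  show "det A \<noteq> 0"
  proof
    assume "det A = 0"
    then have "success_prob (adj2 A) (mat 1) ?b = 0" by (intro z) (simp add: adj2_mult mat_0)
    then have "norm (adj2 A) = 0" using success_prob_quat_diagonal[OF b(1)] m(1) by (simp add: transpose_mat)
    then have "A = 0" using adj0 by simp
    then show False using z[of "mat 1" "mat 1"] m(1)[of "mat 1"] success_prob_quat_diagonal[OF b(1), of "mat 1" "mat 1"]
      unitary_norm[OF unitary_one] by (simp add: transpose_mat)
  qed
  show "det B \<noteq> 0"
  proof
    assume "det B = 0"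
    then have "success_prob (mat 1) (adj2 B) ?b = 0" by (intro z) (simp add: adj2_mult mat_0)
    then have "norm (transpose (adj2 B)) = 0" using success_prob_quat_diagonal[OF b(1)] m(2) by simp
    then have "adj2 B = 0" by (simp add: vec_eq_iff transpose_def)
    then have "B = 0" using adj0 by simp
    then show False using z[of "mat 1" "mat 1"] m(1)[of "mat 1"] success_prob_quat_diagonal[OF b(1), of "mat 1" "mat 1"]
      unitary_norm[OF unitary_one] by (simp add: transpose_mat)
  qed
qed

text \<open>The filters leading to \<open>\<beta>\<close> are invertible, so every filter on
  \<open>\<rho>\<close> is one on \<open>\<beta>\<close>, where the Bell-diagonal bounds and their
  equality case apply.\<close>

lemma optimal_filters_normal_form:
  assumes "state \<rho>" "entangled \<rho>" "bell_diagonal_normal_form \<rho> \<beta>"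
  shows "optimal_filters \<rho> = filters_into \<rho> \<beta>"
    and "(A, B) \<in> filters_into \<rho> \<beta> \<Longrightarrow> fidelity (filtered A B \<rho>) > 1 / 2"
proof -
  obtain A0 B0 where b: "bell_diagonal \<beta>" and f0: "(A0, B0) \<in> filters \<rho>" and \<beta>: "filtered A0 B0 \<rho> = \<beta>"
    using assms(3) unfolding bell_diagonal_normal_form_def by blast
  then have s0: "0 < success_prob A0 B0 \<rho>" by (simp add: filters_def)
  obtain A1 B1 where inv: "A1 ** A0 = mat 1" "B1 ** B0 = mat 1"
    using bell_filters_invertible b \<beta> s0 by (metis invertible_det_nz invertible_left_inverse)
  have inv': "X ** A1 ** A0 = X" "X ** B1 ** B0 = X" for X
    by (simp_all add: matrix_mul_assoc[symmetric] inv)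
  have re: "filtered A B \<rho> = filtered (A ** A1) (B ** B1) \<beta>" for A B
    using filtered_filtered[of A0 B0 \<rho> "A ** A1" "B ** B1"] s0 by (simp add: \<beta> inv')
  have sp: "0 < success_prob (A ** A1) (B ** B1) \<beta>" if "(A, B) \<in> filters \<rho>" for A B
    using that s0 unfolding \<beta>[symmetric] success_prob_filtered inv' by (simp add: filters_def)
  obtain Ag Bg where g: "(Ag, Bg) \<in> filters \<rho>" "1 / 2 < fidelity (filtered Ag Bg \<rho>)"
    by (rule exists_good_filters[OF assms(1,2)])
  \<comment> \<open>If all weights were at most one half, no filter on \<open>\<beta>\<close> could
    exceed fidelity one half, contrary to entanglement of \<open>\<rho>\<close>.\<close>
  then have "\<not> (\<forall>i<4. weight \<beta> i \<le> 1 / 2)"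
    using fidelity_filtered_bell_le_half[OF b _ sp[OF g(1)]] re[of Ag Bg] by force
  then obtain k where k: "k < 4" "1 / 2 < weight \<beta> k" by (auto simp: not_le)
  have le: "fidelity (filtered A B \<rho>) \<le> weight \<beta> k" if "(A, B) \<in> filters \<rho>" for A B
    unfolding re using fidelity_filtered_bell_le(1)[OF b k sp[OF that]] .
  have eq: "locally_unitarily_equivalent (filtered A B \<rho>) \<beta>"
    if "(A, B) \<in> filters \<rho>" "fidelity (filtered A B \<rho>) = weight \<beta> k" for A B
    using fidelity_filtered_bell_eq[OF b k sp[OF that(1)]] that(2) unfolding re by blast
  have f\<beta>: "fidelity \<beta> = weight \<beta> k"
  proof (rule antisym)
    show "fidelity \<beta> \<le> weight \<beta> k" using le[OF f0] \<beta> by simp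
    show "weight \<beta> k \<le> fidelity \<beta>" using fidelity_ge[OF unitary_quat[OF k(1)], of \<beta>] by (simp add: weight_def)
  qed
  have into: "fidelity (filtered A B \<rho>) = weight \<beta> k" if "(A, B) \<in> filters_into \<rho> \<beta>" for A B
    using that fidelity_local_unitary f\<beta> by (auto simp: filters_into_def)
  show "fidelity (filtered A B \<rho>) > 1 / 2" if "(A, B) \<in> filters_into \<rho> \<beta>"
    using into[OF that] k(2) by simp
  show "optimal_filters \<rho> = filters_into \<rho> \<beta>"
  proof (intro set_eqI iffI; clarify)
    fix A B assume o: "(A, B) \<in> optimal_filters \<rho>"
    then have f: "(A, B) \<in> filters \<rho>" by (auto simp: optimal_filters_def)
    have "weight \<beta> k \<le> fidelity (filtered A B \<rho>)"
      using o f0 \<beta> f\<beta> by (auto simp: optimal_filters_def)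
    then show "(A, B) \<in> filters_into \<rho> \<beta>" using le[OF f] eq[OF f] f by (simp add: filters_into_def)
  next
    fix A B assume i: "(A, B) \<in> filters_into \<rho> \<beta>"
    then have "(A, B) \<in> filters \<rho>" by (simp add: filters_into_def)
    then show "(A, B) \<in> optimal_filters \<rho>" using into[OF i] le by (auto simp: optimal_filters_def)
  qed
qed

text \<open>Existence of the normal form is conditional because the optimum need not be attained:
  for a proper mixture of \<open>ket 0 0\<close> with the normalised
  \<open>ket 0 1 + ket 1 0\<close>, filters approach fidelity 1 without reaching it.\<close>

theorem theorem1:
  fixes \<rho> :: two_qubit_op
  assumes "state \<rho>" and "entangled \<rho>"
  shows "(\<forall>\<beta>. bell_diagonal_normal_form \<rho> \<beta> \<longrightarrow>
            optimal_filters \<rho> = filters_into \<rho> \<beta> \<and>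
            (\<forall>(A, B) \<in> filters_into \<rho> \<beta>. fidelity (filtered A B \<rho>) > 1 / 2)) \<and>
         (optimal_filters \<rho> \<noteq> {} \<longrightarrow> (\<exists>\<beta>. bell_diagonal_normal_form \<rho> \<beta>)) \<and>
         (\<exists>(A, B) \<in> filters \<rho>. fidelity (filtered A B \<rho>) > 1 / 2)"
proof (intro conjI allI impI)
  fix \<beta> assume "bell_diagonal_normal_form \<rho> \<beta>"
  from optimal_filters_normal_form[OF assms this]
  show "optimal_filters \<rho> = filters_into \<rho> \<beta>"
    "\<forall>(A, B) \<in> filters_into \<rho> \<beta>. fidelity (filtered A B \<rho>) > 1 / 2" by auto
next
  assume "optimal_filters \<rho> \<noteq> {}"
  then obtain A B where "(A, B) \<in> optimal_filters \<rho>" by auto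
  then obtain \<beta> where "bell_diagonal_normal_form \<rho> \<beta>" by (rule normal_form_of_optimal[OF assms])
  then show "\<exists>\<beta>. bell_diagonal_normal_form \<rho> \<beta>" ..
next
  obtain A B where "(A, B) \<in> filters \<rho>" "fidelity (filtered A B \<rho>) > 1 / 2"
    by (rule exists_good_filters[OF assms])
  then show "\<exists>(A, B) \<in> filters \<rho>. fidelity (filtered A B \<rho>) > 1 / 2"
    by (intro bexI[of _ "(A, B)"]) simp_all
qed

end
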